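(* Let $(\mathbb{X},\mathcal{X})$ be a measurable space and let $\xi$ be a proper point process on $\mathbb{X}$ that admits Papangelou intensity $c$ with respect to a $\sigma$-finite measure $\nu$ on $(\mathbb{X},\mathcal{X})$ such that $\int_{\mathbb{X}}\mathbb{E}|c(x,\xi)|\,\nu(dx)<\infty$. Let $\eta$ be a Poisson process on $\mathbb{X}$ with finite intensity measure $\lambda$ having density $f$ with respect to $\nu$. Then $$d_\pi(\xi,\eta)\le\int_{\mathbb{X}}\mathbb{E}\left|c(x,\xi)-f(x)\right|\nu(dx).$$
   Context: $\mathsf{N}_{\mathbb{X}}$ is the collection of all $\sigma$-finite counting measures on $(\mathbb{X},\mathcal{X})$, equipped with the smallest $\sigma$-field $\mathcal{N}_{\mathbb{X}}$ making $\nu\mapsto\nu(B)$ measurable for all $B\in\mathcal{X}$. A point process on $\mathbb{X}$ is a random element of $(\mathsf{N}_{\mathbb{X}},\mathcal{N}_{\mathbb{X}})$; its intensity measure is $B\mapsto\mathbb{E}[\xi(B)]$, $B\in\mathcal{X}$. A point process $\xi$ is proper if it can be written as $\xi=\delta_{X_1}+\dots+\delta_{X_\tau}$ for some random elements $X_1,X_2,\dots$ in $\mathbb{X}$ and a random variable $\tau\in\mathbb{N}_0\cup\{\infty\}$, where $\mathbb{N}_0=\mathbb{N}\cup\{0\}$. The reduced Campbell measure $\mathcal{C}$ of a proper point process $\xi$ is the measure on $(\mathbb{X}\times\mathsf{N}_{\mathbb{X}},\mathcal{X}\otimes\mathcal{N}_{\mathbb{X}})$ given by $$\mathcal{C}(A)=\mathbb{E}\int_{\mathbb{X}}\mathbf{1}_A(x,\xi\setminus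 x)\,\xi(dx),\quad A\in\mathcal{X}\otimes\mathcal{N}_{\mathbb{X}},$$ where $\xi\setminus x$ denotes $\xi-\delta_x$ if $x\in\xi$, and $\xi$ otherwise. Let $\mathbb{P}_\xi$ be the distribution of $\xi$. If $\mathcal{C}$ is absolutely continuous with respect to $\nu\otimes\mathbb{P}_\xi$, any density $c$ of $\mathcal{C}$ with respect to $\nu\otimes\mathbb{P}_\xi$ is called (a version of) the Papangelou intensity of $\xi$ with respect to $\nu$; equivalently, $$\mathbb{E}\int_{\mathbb{X}}u(x,\xi\setminus x)\,\xi(dx)=\int_{\mathbb{X}}\mathbb{E}[c(x,\xi)u(x,\xi)]\,\nu(dx)$$ for all measurable $u:\mathbb{X}\times\mathsf{N}_{\mathbb{X}}\to[0,\infty)$. $\mathcal{X}^d_{\mathrm{disj}}=\{(A_1,\dots,A_d)\in\mathcal{X}^d: A_i\cap A_j=\emptyset,\ i\neq j\}$. For point processes $\xi,\zeta$ on $\mathbb{X}$ with finite intensity measure (the hypothesis on $c$ ensures that $\xi$ has finite intensity measure), $$d_\pi(\xi,\zeta)=\sup_{(A_1,\dots,A_d)\in\mathcal{X}^d_{\mathrm{disj}},\,d\in\mathbb{N}}d_W\big((\xi(A_1),\dots,\xi(A_d)),(\zeta(A_1),\dots,\zeta(A_d))\big),$$ where for integrable random vectors $\mathbf{X},\mathbf{Y}$ in $\mathbb{N}_0^d$, $d_W(\mathbf{X},\mathbf{Y})=\sup_{g}|\mathbb{E}[g(\mathbf{X})]-\mathbb{E}[g(\mathbf{Y})]|$, the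 supremum being over all $g:\mathbb{N}_0^d\to\mathbb{R}$ with $|g(\mathbf{x})-g(\mathbf{y})|\le\sum_{i=1}^d|x_i-y_i|$ for all $\mathbf{x},\mathbf{y}\in\mathbb{N}_0^d$. (When the intensity measure is finite, these vectors take values in $\mathbb{N}_0^d$ almost surely.) *)

theory Defs
  imports "HOL-Probability.Probability"
begin

section \<open>Counting measures and point processes\<close>

definition counting_measures :: "'a measure \<Rightarrow> 'a measure set" where
  "counting_measures M =
    {\<mu>. sets \<mu> = sets M \<and> sigma_finite_measure \<mu> \<and>
        (\<forall>B\<in>sets M. emeasure \<mu> B \<in> range ennreal_of_enat)}"

definition counting_algebra :: "'a measure \<Rightarrow> 'a measure measure" where
  "counting_algebra M =
    (SUP B\<in>sets M. vimage_algebra (counting_measures M) (\<lambda>\<mu>. emeasure \<mu> B) borel)"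

definition point_process :: "'w measure \<Rightarrow> 'a measure \<Rightarrow> ('w \<Rightarrow> 'a measure) \<Rightarrow> bool" where
  "point_process P M \<xi> \<longleftrightarrow> prob_space P \<and> \<xi> \<in> P \<rightarrow>\<^sub>M counting_algebra M"

text \<open>The sum of the Dirac measures at the points \<open>x i\<close> with \<open>i < t\<close>, on the \<open>\<sigma>\<close>-algebra of \<open>M\<close>.\<close>

definition dirac_sum :: "'a measure \<Rightarrow> enat \<Rightarrow> (nat \<Rightarrow> 'a) \<Rightarrow> 'a measure" where
  "dirac_sum M t x = measure_of (space M) (sets M)
    (\<lambda>B. \<Sum>i. if enat i < t then emeasure (return M (x i)) B else 0)"

text \<open>A point process \<open>\<xi>\<close> is proper if such \<open>X\<close> and \<open>\<tau>\<close> exist. They are arguments of the predicate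
  because the integral in the reduced Campbell measure below refers to the points of the process.\<close>

definition proper_point_process ::
  "'w measure \<Rightarrow> 'a measure \<Rightarrow> ('w \<Rightarrow> 'a measure) \<Rightarrow> (nat \<Rightarrow> 'w \<Rightarrow> 'a) \<Rightarrow> ('w \<Rightarrow> enat) \<Rightarrow> bool" where
  "proper_point_process P M \<xi> X \<tau> \<longleftrightarrow>
    point_process P M \<xi> \<and> (\<forall>i. X i \<in> P \<rightarrow>\<^sub>M M) \<and> \<tau> \<in> P \<rightarrow>\<^sub>M count_space UNIV \<and>
    (AE \<omega> in P. \<xi> \<omega> = dirac_sum M (\<tau> \<omega>) (\<lambda>i. X i \<omega>))"

definition poisson_process ::
  "'w measure \<Rightarrow> 'a measure \<Rightarrow> ('w \<Rightarrow> 'a measure) \<Rightarrow> 'a measure \<Rightarrow> bool" where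
  "poisson_process P M \<eta> \<Lambda> \<longleftrightarrow>
    point_process P M \<eta> \<and> sets \<Lambda> = sets M \<and>
    (\<forall>B\<in>sets M. if emeasure \<Lambda> B = \<infinity> then AE \<omega> in P. emeasure (\<eta> \<omega>) B = \<infinity>
      else \<forall>k::nat. measure P {\<omega>\<in>space P. emeasure (\<eta> \<omega>) B = of_nat k}
             = exp (- measure \<Lambda> B) * measure \<Lambda> B ^ k / fact k) \<and>
    (\<forall>d B. (\<forall>i<d. B i \<in> sets M) \<and> disjoint_family_on B {..<d} \<longrightarrow>
      prob_space.indep_vars P (\<lambda>_::nat. borel) (\<lambda>i \<omega>. emeasure (\<eta> \<omega>) (B i)) {..<d})"


section \<open>Reduced Campbell measure and Papangelou intensity\<close>

text \<open>\<open>\<mu> \<setminus> x\<close>. Singletons need not be measurable, so \<open>x \<in> \<mu>\<close> is read as \<open>\<delta>\<^sub>x \<le> \<mu>\<close>, that is,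
  \<open>\<mu> - \<delta>\<^sub>x\<close> is a measure; if \<open>{x}\<close> is measurable, this says \<open>\<mu> {x} \<ge> 1\<close>.\<close>

definition remove_point :: "'a measure \<Rightarrow> 'a \<Rightarrow> 'a measure" where
  "remove_point \<mu> x =
    (if \<forall>B\<in>sets \<mu>. emeasure (return \<mu> x) B \<le> emeasure \<mu> B
     then diff_measure \<mu> (return \<mu> x) else \<mu>)"

text \<open>For fixed \<open>\<omega>\<close>, the integrand \<open>x \<mapsto> 1\<^sub>A (x, \<xi> \<omega> \<setminus> x)\<close> may fail to be measurable if singletons
  are not measurable. Therefore the inner integral is taken with respect to the same sum
  \<open>\<delta>\<^bsub>X\<^sub>1\<^esub> + \<dots> + \<delta>\<^bsub>X\<^sub>\<tau>\<^esub>\<close>, extended to all subsets of the space. Whenever the integrand is measurable,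
  this is the integral with respect to \<open>\<xi> \<omega>\<close>; see \<open>nn_integral_dirac_sum_count_space\<close> below.\<close>

definition reduced_campbell ::
  "'w measure \<Rightarrow> 'a measure \<Rightarrow> ('w \<Rightarrow> 'a measure) \<Rightarrow> (nat \<Rightarrow> 'w \<Rightarrow> 'a) \<Rightarrow> ('w \<Rightarrow> enat) \<Rightarrow>
    ('a \<times> 'a measure) measure" where
  "reduced_campbell P M \<xi> X \<tau> =
    measure_of (space (M \<Otimes>\<^sub>M counting_algebra M)) (sets (M \<Otimes>\<^sub>M counting_algebra M))
      (\<lambda>A. \<integral>\<^sup>+\<omega>. \<integral>\<^sup>+x. indicator A (x, remove_point (\<xi> \<omega>) x)
              \<partial>dirac_sum (count_space (space M)) (\<tau> \<omega>) (\<lambda>i. X i \<omega>) \<partial>P)"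

definition papangelou_intensity ::
  "'w measure \<Rightarrow> 'a measure \<Rightarrow> ('w \<Rightarrow> 'a measure) \<Rightarrow> (nat \<Rightarrow> 'w \<Rightarrow> 'a) \<Rightarrow> ('w \<Rightarrow> enat) \<Rightarrow>
    'a measure \<Rightarrow> ('a \<times> 'a measure \<Rightarrow> real) \<Rightarrow> bool" where
  "papangelou_intensity P M \<xi> X \<tau> \<nu> c \<longleftrightarrow>
    c \<in> borel_measurable (M \<Otimes>\<^sub>M counting_algebra M) \<and>
    (\<forall>z\<in>space (M \<Otimes>\<^sub>M counting_algebra M). 0 \<le> c z) \<and>
    reduced_campbell P M \<xi> X \<tau> =
      density (\<nu> \<Otimes>\<^sub>M distr P (counting_algebra M) \<xi>) (\<lambda>z. ennreal (c z))"


section \<open>The distance between point processes\<close>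

text \<open>Elements of \<open>\<nat>\<^sub>0\<^sup>d\<close> are lists of length \<open>d\<close>.\<close>

definition lipschitz1 :: "nat \<Rightarrow> (nat list \<Rightarrow> real) set" where
  "lipschitz1 d = {g. \<forall>x y. length x = d \<and> length y = d \<longrightarrow>
    \<bar>g x - g y\<bar> \<le> (\<Sum>i<d. \<bar>real (x ! i) - real (y ! i)\<bar>)}"

definition wasserstein_dist ::
  "nat \<Rightarrow> 'v measure \<Rightarrow> ('v \<Rightarrow> nat list) \<Rightarrow> 'w measure \<Rightarrow> ('w \<Rightarrow> nat list) \<Rightarrow> ennreal" where
  "wasserstein_dist d P X Q Y =
    (SUP g\<in>lipschitz1 d. ennreal \<bar>(\<integral>\<omega>. g (X \<omega>) \<partial>P) - (\<integral>\<omega>. g (Y \<omega>) \<partial>Q)\<bar>)"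

text \<open>\<open>(\<mu> (A\<^sub>1), \<dots>, \<mu> (A\<^sub>d))\<close>, where infinite values, which occur with probability zero under a
  finite intensity measure, are replaced by \<open>0\<close>.\<close>

definition count_vector :: "nat \<Rightarrow> (nat \<Rightarrow> 'a set) \<Rightarrow> 'a measure \<Rightarrow> nat list" where
  "count_vector d A \<mu> = map (\<lambda>i. nat \<lfloor>measure \<mu> (A i)\<rfloor>) [0..<d]"

definition disjoint_tuples :: "'a measure \<Rightarrow> nat \<Rightarrow> (nat \<Rightarrow> 'a set) set" where
  "disjoint_tuples M d = {A. (\<forall>i<d. A i \<in> sets M) \<and> disjoint_family_on A {..<d}}"

text \<open>Only the distributions of the two processes matter, so they may live on different
  probability spaces.\<close>

definition d_pi ::
  "'a measure \<Rightarrow> 'v measure \<Rightarrow> ('v \<Rightarrow> 'a measure) \<Rightarrow> 'w measure \<Rightarrow> ('w \<Rightarrow> 'a measure) \<Rightarrow> ennreal" where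
  "d_pi M P \<xi> Q \<zeta> =
    (SUP d\<in>{1..}. SUP A\<in>disjoint_tuples M d.
      wasserstein_dist d P (\<lambda>\<omega>. count_vector d A (\<xi> \<omega>)) Q (\<lambda>\<omega>. count_vector d A (\<zeta> \<omega>)))"


section \<open>Basic facts\<close>

lemma space_counting_algebra: "space (counting_algebra M) = counting_measures M"
  by (auto simp: counting_algebra_def space_Sup_eq_UN)

lemma measurable_emeasure_counting_algebra:
  "B \<in> sets M \<Longrightarrow> (\<lambda>\<mu>. emeasure \<mu> B) \<in> borel_measurable (counting_algebra M)"
  by (auto intro!: measurable_Sup1 measurable_vimage_algebra1 simp: counting_algebra_def)

lemma measurable_counting_algebra:
  assumes "\<And>\<omega>. \<omega> \<in> space P \<Longrightarrow> F \<omega> \<in> counting_measures M"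
    and "\<And>B. B \<in> sets M \<Longrightarrow> (\<lambda>\<omega>. emeasure (F \<omega>) B) \<in> borel_measurable P"
  shows "F \<in> P \<rightarrow>\<^sub>M counting_algebra M"
  unfolding counting_algebra_def
  using assms by (auto intro!: measurable_Sup2 measurable_vimage_algebra2)

lemma suminf_swap_ennreal:
  fixes f :: "nat \<Rightarrow> nat \<Rightarrow> ennreal"
  shows "(\<Sum>j. \<Sum>i. f i j) = (\<Sum>i. \<Sum>j. f i j)"
proof -
  have "(\<Sum>j. \<Sum>i. f i j) = (\<integral>\<^sup>+j. (\<Sum>i. f i j) \<partial>count_space UNIV)"
    by (simp add: nn_integral_count_space_nat)
  also have "\<dots> = (\<Sum>i. \<integral>\<^sup>+j. f i j \<partial>count_space UNIV)"
    by (rule nn_integral_suminf) simp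
  finally show ?thesis by (simp add: nn_integral_count_space_nat)
qed

lemma sets_dirac_sum [simp]: "sets (dirac_sum M t x) = sets M"
  and space_dirac_sum [simp]: "space (dirac_sum M t x) = space M"
  by (auto simp: dirac_sum_def)

lemma emeasure_dirac_sum:
  assumes "B \<in> sets M"
  shows "emeasure (dirac_sum M t x) B = (\<Sum>i. if enat i < t then indicator B (x i) else 0)"
proof -
  let ?m = "\<lambda>i B. if enat i < t then emeasure (return M (x i)) B else 0"
  have "countably_additive (sets M) (\<lambda>B. \<Sum>i. ?m i B)"
  proof (rule countably_additiveI)
    fix A :: "nat \<Rightarrow> 'a set" assume A: "range A \<subseteq> sets M" "disjoint_family A" "\<Union>(range A) \<in> sets M"
    have "(\<Sum>j. \<Sum>i. ?m i (A j)) = (\<Sum>i. \<Sum>j. ?m i (A j))"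
      by (rule suminf_swap_ennreal)
    also have "\<dots> = (\<Sum>i. ?m i (\<Union>(range A)))"
      using A by (intro arg_cong[where f=suminf] ext) (auto simp del: emeasure_return intro!: suminf_emeasure)
    finally show "(\<Sum>j. \<Sum>i. ?m i (A j)) = (\<Sum>i. ?m i (\<Union>(range A)))" .
  qed
  then have "emeasure (dirac_sum M t x) B = (\<Sum>i. ?m i B)"
    unfolding dirac_sum_def using assms
    by (intro emeasure_measure_of_sigma) (auto simp: positive_def sets.sigma_algebra_axioms cong: if_cong)
  then show ?thesis using assms by (simp cong: if_cong)
qed

lemma nn_integral_dirac_sum:
  assumes g: "g \<in> borel_measurable M" and x: "\<And>i. x i \<in> space M"
  shows "(\<integral>\<^sup>+y. g y \<partial>dirac_sum M t x) = (\<Sum>i. if enat i < t then g (x i) else 0)"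
  using g
proof (induction rule: borel_measurable_induct)
  case (cong f g)
  then show ?case using x by (subst nn_integral_cong[of _ f g]) (auto cong: if_cong)
next
  case (set A)
  then show ?case by (simp add: emeasure_dirac_sum)
next
  case (mult u c)
  then have "(\<integral>\<^sup>+y. c * u y \<partial>dirac_sum M t x) = c * (\<integral>\<^sup>+y. u y \<partial>dirac_sum M t x)"
    by (intro nn_integral_cmult) (simp add: measurable_def)
  also have "\<dots> = (\<Sum>i. c * (if enat i < t then u (x i) else 0))"
    by (simp add: mult.IH)
  finally show ?case by (simp add: if_distrib cong: if_cong)
next
  case (add u v)
  then have "(\<integral>\<^sup>+y. v y + u y \<partial>dirac_sum M t x) =
      (\<integral>\<^sup>+y. v y \<partial>dirac_sum M t x) + (\<integral>\<^sup>+y. u y \<partial>dirac_sum M t x)"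
    by (intro nn_integral_add) (simp_all add: measurable_def)
  also have "\<dots> = (\<Sum>i. (if enat i < t then v (x i) else 0) + (if enat i < t then u (x i) else 0))"
    by (simp add: add.IH suminf_add)
  also have "\<dots> = (\<Sum>i. if enat i < t then v (x i) + u (x i) else 0)"
    by (intro arg_cong[where f=suminf]) auto
  finally show ?case .
next
  case (seq U)
  have "(\<integral>\<^sup>+y. (SUP k. U k) y \<partial>dirac_sum M t x) = (SUP k. \<integral>\<^sup>+y. U k y \<partial>dirac_sum M t x)"
    unfolding SUP_apply using seq(1,3)
    by (intro nn_integral_monotone_convergence_SUP) (simp_all add: measurable_def)
  also have "\<dots> = (SUP k. \<Sum>i. if enat i < t then U k (x i) else 0)"
    by (simp add: seq.IH)
  also have "\<dots> = (\<Sum>i. SUP k. if enat i < t then U k (x i) else 0)"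
    using seq(3) unfolding nn_integral_count_space_nat[symmetric]
    by (intro nn_integral_monotone_convergence_SUP[symmetric])
      (auto simp: incseq_def le_fun_def)
  also have "\<dots> = (\<Sum>i. if enat i < t then (SUP k. U k) (x i) else 0)"
    by (intro arg_cong[where f=suminf]) (auto simp: image_image)
  finally show ?case .
qed

lemma nn_integral_dirac_sum_count_space:
  assumes "g \<in> borel_measurable M" "\<And>i. x i \<in> space M"
  shows "(\<integral>\<^sup>+y. g y \<partial>dirac_sum (count_space (space M)) t x) = (\<integral>\<^sup>+y. g y \<partial>dirac_sum M t x)"
  using assms by (simp add: nn_integral_dirac_sum)

lemma sets_remove_point [simp]: "sets (remove_point \<mu> x) = sets \<mu>"
  by (simp add: remove_point_def)

lemma emeasure_remove_point:
  assumes B: "B \<in> sets \<mu>" and le: "\<And>B. B \<in> sets \<mu> \<Longrightarrow> indicator B x \<le> emeasure \<mu> B"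
  shows "emeasure (remove_point \<mu> x) B = emeasure \<mu> B - indicator B x"
proof -
  let ?d = "\<lambda>A. emeasure \<mu> A - emeasure (return \<mu> x) A"
  have "countably_additive (sets \<mu>) ?d"
  proof (rule countably_additiveI)
    fix A :: "nat \<Rightarrow> 'a set"
    assume A: "range A \<subseteq> sets \<mu>" "disjoint_family A" "\<Union>(range A) \<in> sets \<mu>"
    have meas: "A i \<in> sets \<mu>" for i using A(1) by blast
    have "(\<Sum>i. ?d (A i)) + (\<Sum>i. emeasure (return \<mu> x) (A i)) =
        (\<Sum>i. ?d (A i) + emeasure (return \<mu> x) (A i))"
      by (rule suminf_add) (rule summableI)+
    also have "?d (A i) + emeasure (return \<mu> x) (A i) = emeasure \<mu> (A i)" for i
      by (rule diff_add_cancel_ennreal) (simp add: meas le)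
    then have "(\<Sum>i. ?d (A i) + emeasure (return \<mu> x) (A i)) = (\<Sum>i. emeasure \<mu> (A i))"
      by (rule arg_cong[where f=suminf, OF ext])
    also have "\<dots> = emeasure \<mu> (\<Union>(range A))"
      by (rule suminf_emeasure[OF A(1,2)])
    also have "(\<Sum>i. emeasure (return \<mu> x) (A i)) = emeasure (return \<mu> x) (\<Union>(range A))"
      by (rule suminf_emeasure) (use A in simp_all)
    finally have eq: "(\<Sum>i. ?d (A i)) + emeasure (return \<mu> x) (\<Union>(range A)) =
        emeasure \<mu> (\<Union>(range A))" .
    have fin: "emeasure (return \<mu> x) (\<Union>(range A)) \<noteq> top"
      unfolding emeasure_return[OF A(3)] by (simp add: indicator_def)
    show "(\<Sum>i. ?d (A i)) = ?d (\<Union>(range A))"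
      unfolding eq[symmetric] by (rule ennreal_add_diff_cancel_right[OF fin, symmetric])
  qed
  then have "emeasure (diff_measure \<mu> (return \<mu> x)) B = ?d B"
    unfolding diff_measure_def using B
    by (intro emeasure_measure_of_sigma) (auto simp: positive_def sets.sigma_algebra_axioms)
  then show ?thesis
    using B le by (simp add: remove_point_def)
qed

lemma remove_point_counting_measures:
  assumes \<mu>: "\<mu> \<in> counting_measures M"
  shows "remove_point \<mu> x \<in> counting_measures M"
proof (cases "\<forall>B\<in>sets \<mu>. indicator B x \<le> emeasure \<mu> B")
  case True
  then have em: "emeasure (remove_point \<mu> x) B = emeasure \<mu> B - indicator B x" if "B \<in> sets \<mu>" for B
    using that by (intro emeasure_remove_point) auto
  have [simp]: "sets \<mu> = sets M" using \<mu> by (simp add: counting_measures_def)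
  have [simp]: "space \<mu> = space M" by (rule sets_eq_imp_space_eq) simp
  have "space (remove_point \<mu> x) = space M" by (rule sets_eq_imp_space_eq) simp
  interpret \<mu>: sigma_finite_measure \<mu> using \<mu> by (simp add: counting_measures_def)
  obtain A :: "nat \<Rightarrow> 'a set" where A: "range A \<subseteq> sets \<mu>" "\<Union>(range A) = space \<mu>"
    "\<And>i. emeasure \<mu> (A i) \<noteq> \<infinity>" using \<mu>.sigma_finite by metis
  have "sigma_finite_measure (remove_point \<mu> x)"
  proof (rule sigma_finite_measure.intro, intro exI[of _ "range A"] conjI ballI)
    fix a assume "a \<in> range A"
    then obtain i where a: "a = A i" by auto
    then have "emeasure (remove_point \<mu> x) a \<le> emeasure \<mu> (A i)"
      using A(1) by (subst em) (auto simp: diff_le_self_ennreal)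
    then show "emeasure (remove_point \<mu> x) a \<noteq> \<infinity>" using A(3)[of i] by (auto simp: top_unique)
  qed (use A \<open>space (remove_point \<mu> x) = space M\<close> in auto)
  moreover have "emeasure (remove_point \<mu> x) B \<in> range ennreal_of_enat" if B: "B \<in> sets M" for B
  proof -
    obtain n where n: "emeasure \<mu> B = ennreal_of_enat n"
      using \<mu> B by (auto simp: counting_measures_def)
    have "emeasure \<mu> B - indicator B x = ennreal_of_enat (n - (if x \<in> B then 1 else 0))"
      unfolding n
      by (cases n) (auto simp: indicator_def one_enat_def ennreal_minus_if
        ennreal_of_nat_eq_real_of_nat of_nat_diff simp flip: ennreal_1)
    then show ?thesis using em B by simp
  qed
  ultimately show ?thesis by (auto simp: counting_measures_def)
next
  case False
  then show ?thesis using \<mu> by (auto simp: remove_point_def)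
qed

lemma emeasure_reduced_campbell:
  fixes M :: "'a measure"
  assumes proper: "proper_point_process P M \<xi> X \<tau>"
    and A: "A \<in> sets (M \<Otimes>\<^sub>M counting_algebra M)"
  shows "emeasure (reduced_campbell P M \<xi> X \<tau>) A =
    (\<integral>\<^sup>+\<omega>. \<integral>\<^sup>+x. indicator A (x, remove_point (\<xi> \<omega>) x)
              \<partial>dirac_sum (count_space (space M)) (\<tau> \<omega>) (\<lambda>i. X i \<omega>) \<partial>P)"
proof -
  note [measurable] = measurable_emeasure_counting_algebra
  have pp: "point_process P M \<xi>" and X [measurable]: "\<And>i. X i \<in> P \<rightarrow>\<^sub>M M"
    and \<tau> [measurable]: "\<tau> \<in> P \<rightarrow>\<^sub>M count_space UNIV"
    and ae: "AE \<omega> in P. \<xi> \<omega> = dirac_sum M (\<tau> \<omega>) (\<lambda>i. X i \<omega>)"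
    using proper by (auto simp: proper_point_process_def)
  have \<xi> [measurable]: "\<xi> \<in> P \<rightarrow>\<^sub>M counting_algebra M"
    using pp by (simp add: point_process_def)
  have \<xi>_in: "\<xi> \<omega> \<in> counting_measures M" if "\<omega> \<in> space P" for \<omega>
    using measurable_space[OF \<xi> that] by (simp add: space_counting_algebra)
  obtain N where N: "N \<in> null_sets P"
    "{\<omega>\<in>space P. \<xi> \<omega> \<noteq> dirac_sum M (\<tau> \<omega>) (\<lambda>i. X i \<omega>)} \<subseteq> N"
    using ae unfolding eventually_ae_filter by auto
  have [measurable]: "N \<in> sets P" using N by auto
  define h where "h i \<omega> = (if \<omega> \<notin> N \<and> enat i < \<tau> \<omega> then remove_point (\<xi> \<omega>) (X i \<omega>) else \<xi> \<omega>)"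
    for i \<omega>
  have h [measurable]: "h i \<in> P \<rightarrow>\<^sub>M counting_algebra M" for i
  proof (rule measurable_counting_algebra)
    show "h i \<omega> \<in> counting_measures M" if "\<omega> \<in> space P" for \<omega>
      using \<xi>_in[OF that] by (auto simp: h_def remove_point_counting_measures)
  next
    fix B assume B [measurable]: "B \<in> sets M"
    have eq: "emeasure (h i \<omega>) B =
        (if \<omega> \<notin> N \<and> enat i < \<tau> \<omega> then emeasure (\<xi> \<omega>) B - indicator B (X i \<omega>) else emeasure (\<xi> \<omega>) B)"
      if \<omega>: "\<omega> \<in> space P" for \<omega>
    proof (cases "\<omega> \<notin> N \<and> enat i < \<tau> \<omega>")
      case True
      then have \<xi>_eq: "\<xi> \<omega> = dirac_sum M (\<tau> \<omega>) (\<lambda>i. X i \<omega>)" using N \<omega> by auto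
      have "indicator C (X i \<omega>) \<le> emeasure (\<xi> \<omega>) C" if "C \<in> sets M" for C
        unfolding \<xi>_eq emeasure_dirac_sum[OF that]
        using sum_le_suminf[of "\<lambda>j. if enat j < \<tau> \<omega> then indicator C (X j \<omega>) else 0 :: ennreal" "{i}"] True
        by auto
      then have "emeasure (remove_point (\<xi> \<omega>) (X i \<omega>)) B = emeasure (\<xi> \<omega>) B - indicator B (X i \<omega>)"
        using B by (intro emeasure_remove_point) (auto simp: \<xi>_eq)
      then show ?thesis using True by (simp add: h_def)
    qed (auto simp: h_def)
    show "(\<lambda>\<omega>. emeasure (h i \<omega>) B) \<in> borel_measurable P"
      by (subst measurable_cong[OF eq]) measurable
  qed
  let ?F = "\<lambda>A \<omega>. \<integral>\<^sup>+x. indicator A (x, remove_point (\<xi> \<omega>) x)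
              \<partial>dirac_sum (count_space (space M)) (\<tau> \<omega>) (\<lambda>i. X i \<omega>)"
  let ?S = "\<lambda>A \<omega> i. if enat i < \<tau> \<omega> then indicator A (X i \<omega>, h i \<omega>) else 0 :: ennreal"
  have aeF: "AE \<omega> in P. ?F A \<omega> = (\<Sum>i. ?S A \<omega> i)" for A
    using AE_not_in[OF N(1)]
  proof (rule AE_mp, intro AE_I2 impI)
    fix \<omega> assume "\<omega> \<in> space P" "\<omega> \<notin> N"
    then show "?F A \<omega> = (\<Sum>i. ?S A \<omega> i)"
      using measurable_space[OF X]
      by (subst nn_integral_dirac_sum) (auto simp: h_def intro!: arg_cong[where f=suminf])
  qed
  have F_eq: "(\<integral>\<^sup>+\<omega>. ?F A \<omega> \<partial>P) = (\<integral>\<^sup>+\<omega>. (\<Sum>i. ?S A \<omega> i) \<partial>P)" for A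
    by (rule nn_integral_cong_AE[OF aeF])
  have "countably_additive (sets (M \<Otimes>\<^sub>M counting_algebra M)) (\<lambda>A. \<integral>\<^sup>+\<omega>. ?F A \<omega> \<partial>P)"
  proof (rule countably_additiveI)
    fix C :: "nat \<Rightarrow> ('a \<times> 'a measure) set"
    assume C: "range C \<subseteq> sets (M \<Otimes>\<^sub>M counting_algebra M)" "disjoint_family C"
    have [measurable]: "C j \<in> sets (M \<Otimes>\<^sub>M counting_algebra M)" for j using C by auto
    have "(\<Sum>j. \<integral>\<^sup>+\<omega>. ?F (C j) \<omega> \<partial>P) = (\<integral>\<^sup>+\<omega>. (\<Sum>j. \<Sum>i. ?S (C j) \<omega> i) \<partial>P)"
      unfolding F_eq by (intro nn_integral_suminf[symmetric]) measurable
    also have "\<dots> = (\<integral>\<^sup>+\<omega>. (\<Sum>i. \<Sum>j. ?S (C j) \<omega> i) \<partial>P)"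
      by (intro nn_integral_cong suminf_swap_ennreal)
    also have "\<dots> = (\<integral>\<^sup>+\<omega>. (\<Sum>i. ?S (\<Union>(range C)) \<omega> i) \<partial>P)"
      using suminf_indicator[OF C(2)]
      by (intro nn_integral_cong arg_cong[where f=suminf] ext) auto
    finally show "(\<Sum>j. \<integral>\<^sup>+\<omega>. ?F (C j) \<omega> \<partial>P) = (\<integral>\<^sup>+\<omega>. ?F (\<Union>(range C)) \<omega> \<partial>P)"
      unfolding F_eq .
  qed
  then show ?thesis
    unfolding reduced_campbell_def using A
    by (intro emeasure_measure_of_sigma) (auto simp: positive_def sets.sigma_algebra_axioms)
qed

end

theory Submission
  imports Defs
begin

text \<open>For disjoint \<open>A\<^sub>1, \<dots>, A\<^sub>d\<close> the coordinates of \<open>(\<xi>(A\<^sub>1), \<dots>, \<xi>(A\<^sub>d))\<close> are replaced one after the other by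
  independent Poisson variables with means \<open>\<lambda>(A\<^sub>i)\<close>. Each replacement is estimated by the Chen-Stein
  method: for a 1-Lipschitz \<open>g\<close> the solution \<open>h\<close> of \<open>l h(k + 1) - k h(k) = g(k) - E g(Z)\<close>, with \<open>Z\<close> Poisson
  of mean \<open>l\<close>, satisfies \<open>\<bar>h\<bar> \<le> 1\<close>. Inserting \<open>k = \<xi>(A\<^sub>i)\<close> and rewriting \<open>E[\<xi>(A\<^sub>i) h(\<xi>(A\<^sub>i))]\<close> by means of the
  Papangelou intensity, the error becomes \<open>E[\<integral>\<^bsub>A\<^sub>i\<^esub> (f(x) - c(x, \<xi>)) \<nu>(dx) \<cdot> h(\<xi>(A\<^sub>i) + 1)]\<close>, so it is at most
  \<open>E \<integral>\<^bsub>A\<^sub>i\<^esub> \<bar>c(x, \<xi>) - f(x)\<bar> \<nu>(dx)\<close>. These bounds add up over the disjoint sets \<open>A\<^sub>i\<close>.\<close>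

section \<open>The Stein equation of the Poisson distribution\<close>

text \<open>\<open>poisson_pmf\<close> is specified for positive rates only, but \<open>\<Lambda> (A i) = 0\<close> may occur.\<close>

definition poisson_law :: "real \<Rightarrow> nat pmf" where
  "poisson_law l = (if l = 0 then return_pmf 0 else poisson_pmf l)"

text \<open>Since \<open>0 ^ 0 = 1\<close>, the formula also covers the point mass at
  \<open>l = 0\<close>, so the moment computations below need no separate case.\<close>

lemma pmf_poisson_law:
  assumes "0 \<le> l"
  shows "pmf (poisson_law l) k = l ^ k / fact k * exp (- l)"
  using assms by (cases k) (auto simp: poisson_law_def)

lemma poisson_law_mean:
  assumes l: "0 \<le> l"
  shows "integrable (measure_pmf (poisson_law l)) real"
    and "measure_pmf.expectation (poisson_law l) real = l"
proof -
  let ?f = "\<lambda>k. pmf (poisson_law l) k * real k"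
  \<comment> \<open>These are the terms of the mean shifted by one: cancelling the factor against
    the factorial leaves the exponential series times \<open>l * exp (- l)\<close>.\<close>
  have "(\<lambda>k. (l ^ k /\<^sub>R fact k) * (l * exp (- l))) sums (exp l * (l * exp (- l)))"
    by (intro sums_mult2 exp_converges)
  moreover have "(l ^ k /\<^sub>R fact k) * (l * exp (- l)) = ?f (Suc k)" for k
    using l by (simp add: pmf_poisson_law fact_Suc field_simps del: of_nat_Suc)
  moreover have "exp l * (l * exp (- l)) = l"
    by (simp add: exp_minus field_simps)
  ultimately have "(\<lambda>k. ?f (Suc k)) sums l" by simp
  then have sums: "?f sums l"
    using sums_Suc_iff[of ?f l] by simp
  then have "summable (\<lambda>k. norm (?f k))"
    by (simp add: sums_iff)
  then have int: "integrable (count_space UNIV) ?f"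
    by (simp add: integrable_count_space_nat_iff)
  show "integrable (measure_pmf (poisson_law l)) real"
    unfolding measure_pmf_eq_density using int
    by (subst integrable_density) auto
  have "measure_pmf.expectation (poisson_law l) real = (\<integral>k. ?f k \<partial>count_space UNIV)"
    unfolding measure_pmf_eq_density by (subst integral_density) auto
  also have "\<dots> = l"
    using sums_integral_count_space_nat[OF int] sums by (rule sums_unique2)
  finally show "measure_pmf.expectation (poisson_law l) real = l" .
qed

lemma lipschitz_integrable_pmf:
  fixes p :: "nat pmf" and g :: "nat \<Rightarrow> real"
  assumes int: "integrable (measure_pmf p) real"
    and lip: "\<And>j k. \<bar>g j - g k\<bar> \<le> \<bar>real j - real k\<bar>"
  shows "integrable (measure_pmf p) g"
proof (rule Bochner_Integration.integrable_bound)
  show "integrable (measure_pmf p) (\<lambda>k. \<bar>g 0\<bar> + real k)" using int by simp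
  have "\<bar>g k\<bar> \<le> \<bar>g 0\<bar> + real k" for k using lip[of k 0] by simp
  then show "AE k in measure_pmf p. norm (g k) \<le> norm (\<bar>g 0\<bar> + real k)" by simp
qed simp

text \<open>The centred values \<open>u j - E u\<close> are nondecreasing. If the one at
  \<open>k\<close> is not positive, neither are the earlier ones; otherwise the omitted tail is
  nonnegative, and the whole sum is \<open>0\<close>.\<close>

lemma sum_le_expectation_mono:
  fixes p :: "nat pmf" and u :: "nat \<Rightarrow> real"
  assumes int: "integrable (measure_pmf p) u" and mono: "mono u"
  shows "(\<Sum>j\<le>k. (u j - measure_pmf.expectation p u) * pmf p j) \<le> 0"
proof (cases "u k \<le> measure_pmf.expectation p u")
  case True
  then have "u j \<le> measure_pmf.expectation p u" if "j \<le> k" for j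
    using monoD[OF mono that] by simp
  then show ?thesis by (intro sum_nonpos mult_nonpos_nonneg) auto
next
  case False
  let ?v = "\<lambda>j. u j - measure_pmf.expectation p u"
  have v: "0 \<le> ?v j" if "k \<le> j" for j
    using monoD[OF mono that] False by simp
  have intv: "integrable (measure_pmf p) ?v" using int by simp
  have "(\<Sum>j\<le>k. ?v j * pmf p j) = (\<Sum>j\<le>k. (indicator {..k} j * ?v j) * pmf p j)"
    by (intro sum.cong) auto
  also have "\<dots> = measure_pmf.expectation p (\<lambda>j. indicator {..k} j * ?v j)"
    by (intro integral_measure_pmf_real[symmetric]) (auto simp: indicator_def)
  also have "\<dots> \<le> measure_pmf.expectation p ?v"
    using integrable_real_mult_indicator[OF _ intv, of "{..k}"] v intv
    by (intro integral_mono) (auto simp: indicator_def mult.commute)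
  also have "\<dots> = 0" using int by simp
  finally show ?thesis .
qed

text \<open>The recursion of the Poisson weights makes the sum telescope. In Stein terms, the
  solution for the identity is constantly \<open>-1\<close>, the yardstick for every Lipschitz
  \<open>g\<close>.\<close>

lemma sum_centred_poisson_law:
  assumes "0 \<le> l"
  shows "(\<Sum>j\<le>k. (real j - l) * pmf (poisson_law l) j) = - l * pmf (poisson_law l) k"
proof (induction k)
  case 0
  then show ?case by simp
next
  case (Suc k)
  have "real (Suc k) * pmf (poisson_law l) (Suc k) = l * pmf (poisson_law l) k"
    using assms by (simp add: pmf_poisson_law fact_Suc field_simps del: of_nat_Suc)
  then show ?case using Suc by (simp add: algebra_simps)
qed

text \<open>Comparing \<open>g\<close> with the identity: \<open>k + g k\<close> and \<open>k - g k\<close> are both nondecreasing.\<close>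

lemma poisson_law_lipschitz_sum:
  assumes l: "0 \<le> l" and lip: "\<And>j k. \<bar>g j - g k\<bar> \<le> \<bar>real j - real k\<bar>"
  shows "\<bar>\<Sum>j\<le>k. (g j - measure_pmf.expectation (poisson_law l) g) * pmf (poisson_law l) j\<bar>
    \<le> l * pmf (poisson_law l) k"
proof -
  let ?p = "poisson_law l"
  note int = poisson_law_mean[OF l]
  have g: "integrable (measure_pmf ?p) g"
    using int(1) lip by (rule lipschitz_integrable_pmf)
  have *: "s * (\<Sum>j\<le>k. (g j - measure_pmf.expectation ?p g) * pmf ?p j) \<le> l * pmf ?p k"
    if s: "s = 1 \<or> s = -1" for s :: real
  proof -
    have "mono (\<lambda>k. real k + s * g k)"
    proof (rule monoI)
      fix i j :: nat assume "i \<le> j"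
      then show "real i + s * g i \<le> real j + s * g j" using s lip[of i j] by auto
    qed
    then have "(\<Sum>j\<le>k. (real j + s * g j - measure_pmf.expectation ?p (\<lambda>j. real j + s * g j)) * pmf ?p j) \<le> 0"
      using g int(1) by (intro sum_le_expectation_mono) auto
    also have "measure_pmf.expectation ?p (\<lambda>j. real j + s * g j) = l + s * measure_pmf.expectation ?p g"
      using g int by simp
    also have "(\<Sum>j\<le>k. (real j + s * g j - (l + s * measure_pmf.expectation ?p g)) * pmf ?p j) =
        (\<Sum>j\<le>k. (real j - l) * pmf ?p j) + s * (\<Sum>j\<le>k. (g j - measure_pmf.expectation ?p g) * pmf ?p j)"
      unfolding sum_distrib_left sum.distrib[symmetric]
      by (intro sum.cong refl) (simp add: algebra_simps)
    finally show ?thesis using sum_centred_poisson_law[OF l, of k] by simp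
  qed
  show ?thesis using *[of 1] *[of "-1"] by simp
qed

text \<open>For \<open>l > 0\<close>, multiplying the Stein equation by the Poisson weight makes it
  telescope, which yields the quotient. For \<open>l = 0\<close> the quotient degenerates, and the
  value is read off from the equation at \<open>Suc n\<close>, where only one term survives.\<close>

definition stein_solution :: "real \<Rightarrow> (nat \<Rightarrow> real) \<Rightarrow> nat \<Rightarrow> real" where
  "stein_solution l g n = (if l = 0 then (g 0 - g (Suc n)) / real (Suc n) else
    (\<Sum>j\<le>n. (g j - measure_pmf.expectation (poisson_law l) g) * pmf (poisson_law l) j) /
      (l * pmf (poisson_law l) n))"

text \<open>The denominator is exactly the bound of \<open>poisson_law_lipschitz_sum\<close>; for
  \<open>l = 0\<close> the claim is the Lipschitz condition between \<open>0\<close> and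
  \<open>Suc n\<close>. That the bound is \<open>1\<close> for every \<open>l\<close> keeps
  constants out of the final estimate.\<close>

lemma stein_solution_bound:
  assumes l: "0 \<le> l" and lip: "\<And>j k. \<bar>g j - g k\<bar> \<le> \<bar>real j - real k\<bar>"
  shows "\<bar>stein_solution l g n\<bar> \<le> 1"
proof (cases "l = 0")
  case True
  then show ?thesis using lip[of 0 "Suc n"] by (simp add: stein_solution_def)
next
  case False
  then have "0 < l * pmf (poisson_law l) n" using l by (simp add: pmf_poisson_law)
  then show ?thesis
    using False poisson_law_lipschitz_sum[of l g n] l lip by (simp add: stein_solution_def abs_divide)
qed

text \<open>The index is shifted: \<open>stein_solution l g n\<close> is the value at \<open>n + 1\<close> of the usual solution.\<close>

lemma stein_equation:
  assumes l: "0 \<le> l"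
  shows "g n - measure_pmf.expectation (poisson_law l) g =
    l * stein_solution l g n - real n * stein_solution l g (n - 1)"
proof (cases "l = 0")
  case True
  then show ?thesis by (cases n) (simp_all add: stein_solution_def poisson_law_def)
next
  case False
  let ?p = "pmf (poisson_law l)" and ?g = "\<lambda>j. g j - measure_pmf.expectation (poisson_law l) g"
  have p: "0 < ?p n" for n using False l by (simp add: pmf_poisson_law)
  show ?thesis
  proof (cases n)
    \<comment> \<open>Here \<open>n - 1\<close> is \<open>0\<close> by truncation, but the factor
      \<open>real n\<close> removes that term.\<close>
    case 0
    then show ?thesis using False p[of 0] by (simp add: stein_solution_def)
  next
    case (Suc m)
    \<comment> \<open>This recursion gives both quotients the denominator \<open>?p (Suc m)\<close>,
      so their difference is the last summand divided by it, that is
      \<open>?g (Suc m)\<close>.\<close>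
    have "l * ?p m = real (Suc m) * ?p (Suc m)"
      using l by (simp add: pmf_poisson_law fact_Suc field_simps del: of_nat_Suc)
    then have "real (Suc m) * ((\<Sum>j\<le>m. ?g j * ?p j) / (l * ?p m)) = (\<Sum>j\<le>m. ?g j * ?p j) / ?p (Suc m)"
      by (simp del: of_nat_Suc)
    moreover have "l * ((\<Sum>j\<le>Suc m. ?g j * ?p j) / (l * ?p (Suc m))) = (\<Sum>j\<le>Suc m. ?g j * ?p j) / ?p (Suc m)"
      using False by simp
    ultimately show ?thesis
      using False Suc p[of "Suc m"] by (simp add: stein_solution_def add_divide_distrib del: of_nat_Suc)
  qed
qed

section \<open>Replacing coordinates one at a time\<close>

lemma lipschitz1D:
  assumes "g \<in> lipschitz1 d" "length x = d" "length y = d"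
  shows "\<bar>g x - g y\<bar> \<le> (\<Sum>i<d. \<bar>real (x ! i) - real (y ! i)\<bar>)"
  using assms by (auto simp: lipschitz1_def)

text \<open>With the other coordinates frozen, \<open>g\<close> becomes a 1-Lipschitz function of
  one count, to which the one-dimensional Stein bound applies.\<close>

lemma lipschitz1_list_update:
  assumes g: "g \<in> lipschitz1 d" and x: "length x = d"
  shows "\<bar>g (x[i := j]) - g (x[i := k])\<bar> \<le> \<bar>real j - real k\<bar>"
proof -
  have "\<bar>g (x[i := j]) - g (x[i := k])\<bar> \<le> (\<Sum>n<d. \<bar>real (x[i := j] ! n) - real (x[i := k] ! n)\<bar>)"
    using x by (intro lipschitz1D[OF g]) auto
  also have "\<dots> \<le> (\<Sum>n<d. if n = i then \<bar>real j - real k\<bar> else 0)"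
    using x by (intro sum_mono) (auto simp: nth_list_update)
  \<comment> \<open>Only an inequality, because \<open>i\<close> may lie outside the list; then the
    update changes nothing and the sum is \<open>0\<close>.\<close>
  also have "\<dots> \<le> \<bar>real j - real k\<bar>" by (simp add: sum.delta')
  finally show ?thesis .
qed

lemma lipschitz1_integrable:
  assumes P: "finite_measure P" and g: "g \<in> lipschitz1 d"
    and V [measurable]: "V \<in> P \<rightarrow>\<^sub>M count_space UNIV" and len: "\<And>\<omega>. length (V \<omega>) = d"
    and int: "\<And>i. i < d \<Longrightarrow> integrable P (\<lambda>\<omega>. real (V \<omega> ! i))"
  shows "integrable P (\<lambda>\<omega>. g (V \<omega>))"
proof (rule Bochner_Integration.integrable_bound)
  interpret finite_measure P by (rule P)
  show "integrable P (\<lambda>\<omega>. \<bar>g (replicate d 0)\<bar> + (\<Sum>i<d. real (V \<omega> ! i)))"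
    using int by (intro Bochner_Integration.integrable_add Bochner_Integration.integrable_sum) auto
  have "\<bar>g (V \<omega>)\<bar> \<le> \<bar>g (replicate d 0)\<bar> + (\<Sum>i<d. real (V \<omega> ! i))" for \<omega>
    using lipschitz1D[OF g len[of \<omega>], of "replicate d 0"] by simp
  then show "AE \<omega> in P. norm (g (V \<omega>)) \<le> norm (\<bar>g (replicate d 0)\<bar> + (\<Sum>i<d. real (V \<omega> ! i)))"
    by (intro AE_I2) (simp add: abs_le_iff sum_nonneg)
qed measurable

text \<open>If coordinate \<open>i\<close> has law \<open>p\<close> and is independent of the
  others, this is the conditional expectation of \<open>g\<close> given the others.\<close>

definition resample :: "nat pmf \<Rightarrow> nat \<Rightarrow> (nat list \<Rightarrow> real) \<Rightarrow> nat list \<Rightarrow> real" where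
  "resample p i g x = measure_pmf.expectation p (\<lambda>k. g (x[i := k]))"

text \<open>Both lists receive the same value \<open>k\<close> at position \<open>i\<close>, so no
  coordinate distance grows. This keeps the test function admissible for the next
  replacement.\<close>

lemma resample_lipschitz1:
  assumes p: "integrable (measure_pmf p) real" and g: "g \<in> lipschitz1 d"
  shows "resample p i g \<in> lipschitz1 d"
proof -
  have "\<bar>resample p i g x - resample p i g y\<bar> \<le> (\<Sum>j<d. \<bar>real (x ! j) - real (y ! j)\<bar>)"
    if x: "length x = d" and y: "length y = d" for x y
  proof -
    have int: "integrable (measure_pmf p) (\<lambda>k. g (z[i := k]))" if "length z = d" for z
      using p lipschitz1_list_update[OF g that] by (rule lipschitz_integrable_pmf)
    have le: "\<bar>g (x[i := k]) - g (y[i := k])\<bar> \<le> (\<Sum>j<d. \<bar>real (x ! j) - real (y ! j)\<bar>)" for k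
    proof -
      have "\<bar>g (x[i := k]) - g (y[i := k])\<bar> \<le> (\<Sum>j<d. \<bar>real (x[i := k] ! j) - real (y[i := k] ! j)\<bar>)"
        using x y by (intro lipschitz1D[OF g]) auto
      also have "\<dots> \<le> (\<Sum>j<d. \<bar>real (x ! j) - real (y ! j)\<bar>)"
      proof (rule sum_mono)
        fix j assume "j \<in> {..<d}"
        then show "\<bar>real (x[i := k] ! j) - real (y[i := k] ! j)\<bar> \<le> \<bar>real (x ! j) - real (y ! j)\<bar>"
          using x y by (cases "i = j") auto
      qed
      finally show ?thesis .
    qed
    have "\<bar>resample p i g x - resample p i g y\<bar> =
        \<bar>measure_pmf.expectation p (\<lambda>k. g (x[i := k]) - g (y[i := k]))\<bar>"
      using int[OF x] int[OF y] by (simp add: resample_def)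
    also have "\<dots> \<le> measure_pmf.expectation p (\<lambda>k. \<bar>g (x[i := k]) - g (y[i := k])\<bar>)"
      by (rule integral_abs_bound)
    also have "\<dots> \<le> measure_pmf.expectation p (\<lambda>k. \<Sum>j<d. \<bar>real (x ! j) - real (y ! j)\<bar>)"
      using int[OF x] int[OF y] le by (intro integral_mono) auto
    finally show ?thesis by simp
  qed
  then show ?thesis by (auto simp: lipschitz1_def)
qed

text \<open>\<open>E\<^sub>1\<close> and \<open>E\<^sub>2\<close> stand for expectations; after all coordinates have been resampled the test
  function is constant.\<close>

lemma resample_telescope:
  fixes E1 E2 :: "(nat list \<Rightarrow> real) \<Rightarrow> real"
  assumes p: "\<And>i. i < d \<Longrightarrow> integrable (measure_pmf (p i)) real"
    and E1: "\<And>g i. g \<in> lipschitz1 d \<Longrightarrow> i < d \<Longrightarrow> \<bar>E1 g - E1 (resample (p i) i g)\<bar> \<le> \<epsilon> i"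
    and E2: "\<And>g i. g \<in> lipschitz1 d \<Longrightarrow> i < d \<Longrightarrow> E2 g = E2 (resample (p i) i g)"
    and const: "\<And>g. (\<And>x y. length x = d \<Longrightarrow> length y = d \<Longrightarrow> g x = g y) \<Longrightarrow> E1 g = E2 g"
    and g: "g \<in> lipschitz1 d"
  shows "\<bar>E1 g - E2 g\<bar> \<le> (\<Sum>i<d. \<epsilon> i)"
proof -
  \<comment> \<open>Here \<open>h\<close> is the test function after \<open>n\<close> replacements:
    the errors so far are collected in the sum, and \<open>h\<close> no longer depends on the
    coordinates below \<open>n\<close>.\<close>
  have "\<exists>h\<in>lipschitz1 d. \<bar>E1 g - E2 g\<bar> \<le> (\<Sum>i<n. \<epsilon> i) + \<bar>E1 h - E2 h\<bar> \<and>
      (\<forall>x y. length x = d \<longrightarrow> length y = d \<longrightarrow> (\<forall>i. n \<le> i \<longrightarrow> i < d \<longrightarrow> x ! i = y ! i) \<longrightarrow> h x = h y)"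
    if "n \<le> d" for n
    using that
  proof (induction n)
    case 0
    then show ?case using g by (intro bexI[of _ g]) (auto intro!: arg_cong[where f=g] nth_equalityI)
  next
    case (Suc n)
    then obtain h where h: "h \<in> lipschitz1 d"
      "\<bar>E1 g - E2 g\<bar> \<le> (\<Sum>i<n. \<epsilon> i) + \<bar>E1 h - E2 h\<bar>"
      "\<And>x y. length x = d \<Longrightarrow> length y = d \<Longrightarrow> (\<And>i. n \<le> i \<Longrightarrow> i < d \<Longrightarrow> x ! i = y ! i) \<Longrightarrow> h x = h y"
      by auto
    show ?case
    proof (intro bexI[of _ "resample (p n) n h"] conjI allI impI)
      show "resample (p n) n h \<in> lipschitz1 d"
        using p[of n] h(1) Suc.prems by (intro resample_lipschitz1) auto
      \<comment> \<open>Resampling leaves \<open>E2\<close> unchanged, so only \<open>E1\<close>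
        contributes an error, at most \<open>\<epsilon> n\<close>.\<close>
      show "\<bar>E1 g - E2 g\<bar> \<le> (\<Sum>i<Suc n. \<epsilon> i) + \<bar>E1 (resample (p n) n h) - E2 (resample (p n) n h)\<bar>"
        using h(2) E1[OF h(1), of n] E2[OF h(1), of n] Suc.prems by simp
      fix x y :: "nat list"
      assume xy: "length x = d" "length y = d" "\<forall>i. Suc n \<le> i \<longrightarrow> i < d \<longrightarrow> x ! i = y ! i"
      have "h (x[n := k]) = h (y[n := k])" for k
        using xy by (intro h(3)) (auto simp: nth_list_update)
      then show "resample (p n) n h x = resample (p n) n h y" by (simp add: resample_def)
    qed
  qed
  from this[of d] obtain h where h: "\<bar>E1 g - E2 g\<bar> \<le> (\<Sum>i<d. \<epsilon> i) + \<bar>E1 h - E2 h\<bar>"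
    "\<And>x y. length x = d \<Longrightarrow> length y = d \<Longrightarrow> h x = h y" by auto
  have "E1 h = E2 h" using h(2) by (rule const)
  then show ?thesis using h(1) by simp
qed

section \<open>Resampling an independent coordinate\<close>

lemma measurable_map_count_space:
  fixes f :: "'i \<Rightarrow> 'b \<Rightarrow> nat"
  assumes "\<And>i. i \<in> set is \<Longrightarrow> f i \<in> P \<rightarrow>\<^sub>M count_space UNIV"
  shows "(\<lambda>\<omega>. map (\<lambda>i. f i \<omega>) is) \<in> P \<rightarrow>\<^sub>M count_space UNIV"
  using assms
proof (induction "is")
  case (Cons i "is")
  have "(\<lambda>\<omega>. a # map (\<lambda>i. f i \<omega>) is) \<in> P \<rightarrow>\<^sub>M count_space UNIV" for a
    using Cons by (intro measurable_compose[of _ P "count_space UNIV" "\<lambda>xs. a # xs"]) auto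
  from measurable_compose_countable[OF this, of "f i"] Cons.prems show ?case by simp
qed simp

text \<open>Independence makes the joint law of coordinate \<open>i\<close> and the remaining ones a
  product measure; in Fubini's theorem the inner integral is then \<open>resample\<close>.\<close>

lemma (in prob_space) expectation_resample:
  assumes V: "\<And>\<omega>. length (V \<omega>) = d"
    and ind: "indep_vars (\<lambda>_. count_space UNIV) (\<lambda>i \<omega>. V \<omega> ! i) {..<d}"
    and i: "i < d" and p: "distr M (count_space UNIV) (\<lambda>\<omega>. V \<omega> ! i) = measure_pmf p"
    and int: "integrable M (\<lambda>\<omega>. g (V \<omega>))"
  shows "expectation (\<lambda>\<omega>. g (V \<omega>)) = expectation (\<lambda>\<omega>. resample p i g (V \<omega>))"
proof -
  let ?C = "count_space UNIV :: nat measure" and ?L = "count_space UNIV :: nat list measure"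
  \<comment> \<open>\<open>?W\<close> rebuilds a list from the other coordinates, with
    \<open>0\<close> as a placeholder at position \<open>i\<close>; both \<open>?g\<close> and
    \<open>resample\<close> overwrite it.\<close>
  let ?J = "{..<d} - {i}" and ?W = "\<lambda>r. map (\<lambda>j. if j = i then 0 else r j) [0..<d] :: nat list"
  text \<open>The \<open>i\<close>-th count is wrapped into a singleton list because \<open>indep_var\<close> requires both
    random variables to have the same type.\<close>
  have "indep_var (PiM ?J (\<lambda>_. ?C)) (\<lambda>\<omega>. restrict (\<lambda>i. V \<omega> ! i) ?J)
      (PiM {i} (\<lambda>_. ?C)) (\<lambda>\<omega>. restrict (\<lambda>i. V \<omega> ! i) {i})"
    using ind i by (intro indep_var_restrict) auto
  moreover have "?W \<in> PiM ?J (\<lambda>_. ?C) \<rightarrow>\<^sub>M ?L"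
  proof (rule measurable_map_count_space)
    fix j assume "j \<in> set [0..<d]"
    then show "(\<lambda>r. if j = i then 0 else r j) \<in> PiM ?J (\<lambda>_. ?C) \<rightarrow>\<^sub>M ?C"
      by (cases "j = i") (auto intro: measurable_component_singleton)
  qed
  moreover have "(\<lambda>r. [r i]) \<in> PiM {i} (\<lambda>_. ?C) \<rightarrow>\<^sub>M ?L"
    by (rule measurable_compose[OF measurable_component_singleton]) auto
  ultimately have "indep_var ?L (?W \<circ> (\<lambda>\<omega>. restrict (\<lambda>i. V \<omega> ! i) ?J))
      ?L ((\<lambda>r. [r i]) \<circ> (\<lambda>\<omega>. restrict (\<lambda>i. V \<omega> ! i) {i}))"
    by (rule indep_var_compose)
  moreover have "?W \<circ> (\<lambda>\<omega>. restrict (\<lambda>i. V \<omega> ! i) ?J) = (\<lambda>\<omega>. (V \<omega>)[i := 0])"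
    using V by (auto simp: fun_eq_iff nth_list_update intro!: nth_equalityI)
  moreover have "(\<lambda>r. [r i]) \<circ> (\<lambda>\<omega>. restrict (\<lambda>i. V \<omega> ! i) {i}) = (\<lambda>\<omega>. [V \<omega> ! i])"
    by (auto simp: fun_eq_iff)
  ultimately have "indep_var ?L (\<lambda>\<omega>. (V \<omega>)[i := 0]) ?L (\<lambda>\<omega>. [V \<omega> ! i])" by simp
  then have [measurable]: "(\<lambda>\<omega>. (V \<omega>)[i := 0]) \<in> M \<rightarrow>\<^sub>M ?L" "(\<lambda>\<omega>. [V \<omega> ! i]) \<in> M \<rightarrow>\<^sub>M ?L"
    and joint: "distr M ?L (\<lambda>\<omega>. (V \<omega>)[i := 0]) \<Otimes>\<^sub>M distr M ?L (\<lambda>\<omega>. [V \<omega> ! i]) =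
      distr M (?L \<Otimes>\<^sub>M ?L) (\<lambda>\<omega>. ((V \<omega>)[i := 0], [V \<omega> ! i]))"
    unfolding indep_var_distribution_eq by auto
  have Vi: "(\<lambda>\<omega>. V \<omega> ! i) \<in> M \<rightarrow>\<^sub>M ?C"
    using ind i by (auto simp: indep_vars_def)
  \<comment> \<open>Lists of naturals are countable, so the product is again discrete and every
    function on it, such as \<open>?g\<close>, is measurable.\<close>
  have [simp]: "?L \<Otimes>\<^sub>M ?L = count_space UNIV"
    by (subst pair_measure_countable) auto
  let ?D = "distr M ?L (\<lambda>\<omega>. (V \<omega>)[i := 0])" and ?E = "distr M ?L (\<lambda>\<omega>. [V \<omega> ! i])"
  let ?g = "\<lambda>(x, l). g (x[i := hd l])"
  interpret D: prob_space ?D by (rule prob_space_distr) measurable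
  interpret E: prob_space ?E by (rule prob_space_distr) measurable
  interpret pair_sigma_finite ?D ?E ..
  have pair: "(\<lambda>\<omega>. ((V \<omega>)[i := 0], [V \<omega> ! i])) \<in> M \<rightarrow>\<^sub>M ?L \<Otimes>\<^sub>M ?L" by measurable
  have "integrable (?D \<Otimes>\<^sub>M ?E) ?g"
    unfolding joint using pair int by (subst integrable_distr_eq) auto
  then have "(\<integral>x. (\<integral>l. ?g (x, l) \<partial>?E) \<partial>?D) = integral\<^sup>L (?D \<Otimes>\<^sub>M ?E) ?g"
    by (rule integral_fst')
  also have "\<dots> = expectation (\<lambda>\<omega>. g (V \<omega>))"
    unfolding joint using pair by (subst integral_distr) auto
  also have "(\<integral>l. ?g (x, l) \<partial>?E) = resample p i g x" for x
    unfolding resample_def p[symmetric] by (simp add: integral_distr Vi)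
  then have "(\<integral>x. (\<integral>l. ?g (x, l) \<partial>?E) \<partial>?D) = expectation (\<lambda>\<omega>. resample p i g ((V \<omega>)[i := 0]))"
    by (simp add: integral_distr)
  finally show ?thesis by (simp add: resample_def)
qed

section \<open>Counts of a point process\<close>

lemma length_count_vector [simp]: "length (count_vector d A \<mu>) = d"
  by (simp add: count_vector_def)

lemma nth_count_vector [simp]: "i < d \<Longrightarrow> count_vector d A \<mu> ! i = nat \<lfloor>measure \<mu> (A i)\<rfloor>"
  by (simp add: count_vector_def)

lemma emeasure_counting_measure:
  assumes "\<mu> \<in> counting_measures M" "B \<in> sets M" "emeasure \<mu> B \<noteq> \<infinity>"
  shows "emeasure \<mu> B = of_nat (nat \<lfloor>measure \<mu> B\<rfloor>)"
proof -
  obtain n where n: "emeasure \<mu> B = ennreal_of_enat n"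
    using assms by (auto simp: counting_measures_def)
  then obtain k where "emeasure \<mu> B = of_nat k"
    using assms(3) by (cases n) auto
  then show ?thesis by (simp add: measure_def)
qed

lemma measurable_count:
  assumes "B \<in> sets M"
  shows "(\<lambda>\<mu>. nat \<lfloor>measure \<mu> B\<rfloor>) \<in> counting_algebra M \<rightarrow>\<^sub>M count_space UNIV"
proof -
  note [measurable] = measurable_emeasure_counting_algebra[OF assms]
  show ?thesis unfolding measure_def by measurable
qed

lemma measurable_count_vector:
  assumes "\<And>i. i < d \<Longrightarrow> A i \<in> sets M"
  shows "count_vector d A \<in> counting_algebra M \<rightarrow>\<^sub>M count_space UNIV"
  using assms unfolding count_vector_def[abs_def]
  by (intro measurable_map_count_space measurable_count) auto

text \<open>By disjointness \<open>y\<close> lies in \<open>A i\<close> and in no other set of the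
  tuple, so only one count drops. The condition \<open>le\<close> says that \<open>y\<close> is a
  point of \<open>\<mu>\<close>, so that \<open>remove_point\<close> does subtract.\<close>

lemma count_vector_remove_point:
  assumes A: "A \<in> disjoint_tuples M d" and i: "i < d" "y \<in> A i"
    and \<mu>: "\<mu> \<in> counting_measures M" and fin: "\<And>j. j < d \<Longrightarrow> emeasure \<mu> (A j) \<noteq> \<infinity>"
    and le: "\<And>B. B \<in> sets M \<Longrightarrow> indicator B y \<le> emeasure \<mu> B"
  shows "count_vector d A (remove_point \<mu> y) =
    (count_vector d A \<mu>)[i := count_vector d A \<mu> ! i - 1]"
proof (rule nth_equalityI)
  fix j assume "j < length (count_vector d A (remove_point \<mu> y))"
  then have j: "j < d" by simp
  have sets: "sets \<mu> = sets M" using \<mu> by (simp add: counting_measures_def)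
  have Aj: "A j \<in> sets M" using A j by (simp add: disjoint_tuples_def)
  have em: "emeasure \<mu> (A j) = of_nat (nat \<lfloor>measure \<mu> (A j)\<rfloor>)"
    using \<mu> Aj fin[OF j] by (rule emeasure_counting_measure)
  \<comment> \<open>Subtraction truncates at \<open>0\<close> on both sides, so a zero count needs
    no exclusion.\<close>
  have diff: "(of_nat n :: ennreal) - (if j = i then 1 else 0) = of_nat (n - (if j = i then 1 else 0))" for n
    by (cases n) (auto simp: ennreal_minus_if ennreal_of_nat_eq_real_of_nat simp flip: ennreal_1)
  have "y \<in> A j \<longleftrightarrow> j = i"
    using A i j by (auto simp: disjoint_tuples_def disjoint_family_on_def)
  then have "emeasure (remove_point \<mu> y) (A j) = emeasure \<mu> (A j) - (if j = i then 1 else 0)"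
    using emeasure_remove_point[of "A j" \<mu> y] Aj le by (simp add: sets indicator_def)
  also have "\<dots> = of_nat (nat \<lfloor>measure \<mu> (A j)\<rfloor> - (if j = i then 1 else 0))"
    using diff[of "nat \<lfloor>measure \<mu> (A j)\<rfloor>"] by (simp only: em[symmetric])
  finally show "count_vector d A (remove_point \<mu> y) ! j =
      (count_vector d A \<mu>)[i := count_vector d A \<mu> ! i - 1] ! j"
    using j by (auto simp: measure_def[of "remove_point \<mu> y"] nth_list_update)
qed simp

text \<open>If membership in \<open>S\<close> after a removal does not depend on which point of
  \<open>B\<close> is removed, it factors out of the sum over the points, and what remains counts
  the points in \<open>B\<close>.\<close>

lemma nn_integral_dirac_sum_remove_point:
  assumes \<mu>: "\<mu> = dirac_sum M t x" and x: "\<And>i. x i \<in> space M" and B: "B \<in> sets M"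
    and Q: "\<And>y. y \<in> B \<Longrightarrow> (\<And>C. C \<in> sets M \<Longrightarrow> indicator C y \<le> emeasure \<mu> C) \<Longrightarrow>
      remove_point \<mu> y \<in> S \<longleftrightarrow> Q"
  shows "(\<integral>\<^sup>+y. indicator (B \<times> S) (y, remove_point \<mu> y) \<partial>dirac_sum (count_space (space M)) t x) =
    emeasure \<mu> B * of_bool Q"
proof -
  \<comment> \<open>One summand of the Dirac sum already dominates the indicator, so
    \<open>x i\<close> is a point of \<open>\<mu>\<close> in the sense of
    \<open>remove_point\<close>.\<close>
  have "indicator C (x i) \<le> emeasure \<mu> C" if "enat i < t" "C \<in> sets M" for i C
    unfolding \<mu> emeasure_dirac_sum[OF that(2)]
    using sum_le_suminf[of "\<lambda>j. if enat j < t then indicator C (x j) else 0 :: ennreal" "{i}"] that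
    by auto
  then have eq: "(if enat i < t then indicator (B \<times> S) (x i, remove_point \<mu> (x i)) else 0 :: ennreal) =
      (if enat i < t then indicator B (x i) else 0) * of_bool Q" for i
    using Q[of "x i"] by (auto simp: indicator_def)
  have "(\<integral>\<^sup>+y. indicator (B \<times> S) (y, remove_point \<mu> y) \<partial>dirac_sum (count_space (space M)) t x) =
      (\<Sum>i. (if enat i < t then indicator B (x i) else 0) * of_bool Q)"
    using x by (subst nn_integral_dirac_sum) (auto simp: eq cong: if_cong)
  also have "\<dots> = emeasure \<mu> B * of_bool Q"
    unfolding \<mu> emeasure_dirac_sum[OF B] by (rule ennreal_suminf_multc)
  finally show ?thesis .
qed

text \<open>The triangle inequality, applied in both directions. The right side may be infinite,
  since finiteness is required of the positive parts only.\<close>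

lemma abs_diff_nn_integral_le:
  fixes u v :: "'a \<Rightarrow> real"
  assumes [measurable]: "u \<in> borel_measurable M" "v \<in> borel_measurable M"
    and fin: "(\<integral>\<^sup>+x. ennreal (u x) \<partial>M) \<noteq> \<infinity>" "(\<integral>\<^sup>+x. ennreal (v x) \<partial>M) \<noteq> \<infinity>"
  shows "ennreal \<bar>enn2real (\<integral>\<^sup>+x. ennreal (u x) \<partial>M) - enn2real (\<integral>\<^sup>+x. ennreal (v x) \<partial>M)\<bar>
    \<le> (\<integral>\<^sup>+x. ennreal \<bar>u x - v x\<bar> \<partial>M)"
proof -
  have le: "(\<integral>\<^sup>+x. ennreal (f x) \<partial>M) \<le> (\<integral>\<^sup>+x. ennreal (h x) \<partial>M) + (\<integral>\<^sup>+x. ennreal \<bar>u x - v x\<bar> \<partial>M)"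
    if [measurable]: "h \<in> borel_measurable M" and fh: "\<And>x. f x \<le> h x + \<bar>u x - v x\<bar>" for f h
  proof -
    have "ennreal (f x) \<le> ennreal (h x) + ennreal \<bar>u x - v x\<bar>" for x
    proof -
      \<comment> \<open>\<open>ennreal\<close> sends negative numbers to \<open>0\<close>; passing
        to \<open>max 0 (h x)\<close> makes it additive.\<close>
      have "ennreal (f x) \<le> ennreal (max 0 (h x) + \<bar>u x - v x\<bar>)"
        using fh[of x] by (intro ennreal_leI) linarith
      also have "\<dots> = ennreal (h x) + ennreal \<bar>u x - v x\<bar>"
        by (subst ennreal_plus) (auto simp: ennreal_max_0)
      finally show ?thesis .
    qed
    then have "(\<integral>\<^sup>+x. ennreal (f x) \<partial>M) \<le> (\<integral>\<^sup>+x. ennreal (h x) + ennreal \<bar>u x - v x\<bar> \<partial>M)"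
      by (intro nn_integral_mono)
    then show ?thesis by (subst (asm) nn_integral_add) auto
  qed
  obtain a where a: "0 \<le> a" "(\<integral>\<^sup>+x. ennreal (u x) \<partial>M) = ennreal a"
    using fin(1) by (cases "\<integral>\<^sup>+x. ennreal (u x) \<partial>M") auto
  obtain b where b: "0 \<le> b" "(\<integral>\<^sup>+x. ennreal (v x) \<partial>M) = ennreal b"
    using fin(2) by (cases "\<integral>\<^sup>+x. ennreal (v x) \<partial>M") auto
  show ?thesis
  proof (cases "\<integral>\<^sup>+x. ennreal \<bar>u x - v x\<bar> \<partial>M")
    case (real r)
    have "ennreal a \<le> ennreal (b + r)" "ennreal b \<le> ennreal (a + r)"
      using le[of v u] le[of u v] a b real by (auto simp: ennreal_plus)
    then have "a \<le> b + r" "b \<le> a + r"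
      using a b real by (simp_all add: ennreal_le_iff del: ennreal_plus)
    then have "\<bar>a - b\<bar> \<le> r" by linarith
    then show ?thesis using a b real by (auto intro: ennreal_leI)
  qed simp
qed

section \<open>Processes with a Papangelou intensity\<close>

locale papangelou_process =
  fixes P :: "'v measure" and M :: "'a measure" and \<xi> :: "'v \<Rightarrow> 'a measure"
    and X :: "nat \<Rightarrow> 'v \<Rightarrow> 'a" and \<tau> :: "'v \<Rightarrow> enat" and \<nu> :: "'a measure"
    and c :: "'a \<times> 'a measure \<Rightarrow> real"
  assumes proper: "proper_point_process P M \<xi> X \<tau>"
    and papangelou: "papangelou_intensity P M \<xi> X \<tau> \<nu> c"
    and sets_\<nu> [measurable_cong]: "sets \<nu> = sets M" and sigma_finite_\<nu>: "sigma_finite_measure \<nu>"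
    and intensity_finite: "(\<integral>\<^sup>+x. \<integral>\<^sup>+\<omega>. ennreal \<bar>c (x, \<xi> \<omega>)\<bar> \<partial>P \<partial>\<nu>) < \<infinity>"
begin

sublocale prob_space P
  using proper by (simp add: proper_point_process_def point_process_def)

lemma \<xi>_measurable [measurable]: "\<xi> \<in> P \<rightarrow>\<^sub>M counting_algebra M"
  using proper by (simp add: proper_point_process_def point_process_def)

lemma \<xi>_counting: "\<omega> \<in> space P \<Longrightarrow> \<xi> \<omega> \<in> counting_measures M"
  using measurable_space[OF \<xi>_measurable] by (simp add: space_counting_algebra)

lemma c_measurable [measurable]: "c \<in> borel_measurable (M \<Otimes>\<^sub>M counting_algebra M)"
  using papangelou by (simp add: papangelou_intensity_def)

lemma space_\<nu>: "space \<nu> = space M"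
  by (rule sets_eq_imp_space_eq[OF sets_\<nu>])

lemma pair_P_\<nu>: "pair_sigma_finite \<nu> P"
  using sigma_finite_\<nu> sigma_finite_measure_axioms by (rule pair_sigma_finite.intro)

text \<open>Plays the role of the Poisson parameter in the size-biasing identity
  \<open>E[N h(N - 1)] = E[conditional_mass B \<cdot> h(N)]\<close> for \<open>N = \<xi>(B)\<close>.\<close>

definition conditional_mass :: "'a set \<Rightarrow> 'v \<Rightarrow> ennreal" where
  "conditional_mass B \<omega> = (\<integral>\<^sup>+x. ennreal (c (x, \<xi> \<omega>)) * indicator B x \<partial>\<nu>)"

lemma conditional_mass_measurable [measurable]:
  assumes [measurable]: "B \<in> sets M"
  shows "conditional_mass B \<in> borel_measurable P"
proof -
  interpret pair_sigma_finite \<nu> P by (rule pair_P_\<nu>)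
  show ?thesis unfolding conditional_mass_def[abs_def] by measurable
qed

text \<open>The density form of the Campbell measure on a rectangle: Fubini moves the integral over
  \<open>\<nu>\<close> inside, where it becomes \<open>conditional_mass\<close>.\<close>

lemma emeasure_reduced_campbell_times:
  assumes B [measurable]: "B \<in> sets M" and S [measurable]: "S \<in> sets (counting_algebra M)"
  shows "emeasure (reduced_campbell P M \<xi> X \<tau>) (B \<times> S) =
    (\<integral>\<^sup>+\<omega>. conditional_mass B \<omega> * indicator S (\<xi> \<omega>) \<partial>P)"
proof -
  let ?D = "distr P (counting_algebra M) \<xi>"
  interpret pair_sigma_finite \<nu> P by (rule pair_P_\<nu>)
  interpret D: prob_space ?D by (rule prob_space_distr) measurable
  have "emeasure (reduced_campbell P M \<xi> X \<tau>) (B \<times> S) =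
      (\<integral>\<^sup>+z. ennreal (c z) * indicator (B \<times> S) z \<partial>(\<nu> \<Otimes>\<^sub>M ?D))"
    using papangelou unfolding papangelou_intensity_def by (simp add: emeasure_density)
  also have "\<dots> = (\<integral>\<^sup>+x. \<integral>\<^sup>+\<mu>. ennreal (c (x, \<mu>)) * indicator (B \<times> S) (x, \<mu>) \<partial>?D \<partial>\<nu>)"
    by (subst D.nn_integral_fst[symmetric]) measurable
  also have "\<dots> = (\<integral>\<^sup>+x. \<integral>\<^sup>+\<omega>. ennreal (c (x, \<xi> \<omega>)) * indicator (B \<times> S) (x, \<xi> \<omega>) \<partial>P \<partial>\<nu>)"
    by (intro nn_integral_cong nn_integral_distr) (auto simp: space_\<nu>)
  also have "\<dots> = (\<integral>\<^sup>+\<omega>. \<integral>\<^sup>+x. ennreal (c (x, \<xi> \<omega>)) * indicator (B \<times> S) (x, \<xi> \<omega>) \<partial>\<nu> \<partial>P)"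
    by (rule Fubini'[symmetric]) measurable
  also have "\<dots> = (\<integral>\<^sup>+\<omega>. \<integral>\<^sup>+x. ennreal (c (x, \<xi> \<omega>)) * indicator B x * indicator S (\<xi> \<omega>) \<partial>\<nu> \<partial>P)"
    by (intro nn_integral_cong) (auto simp: indicator_def)
  also have "\<dots> = (\<integral>\<^sup>+\<omega>. conditional_mass B \<omega> * indicator S (\<xi> \<omega>) \<partial>P)"
    unfolding conditional_mass_def by (intro nn_integral_cong nn_integral_multc) measurable
  finally show ?thesis .
qed

text \<open>Evaluates the reduced Campbell measure of \<open>B \<times> S\<close> twice: over the
  points of \<open>\<xi>\<close> and through the density \<open>c\<close>. As \<open>Q\<close> does
  not depend on the removed point, the sum over the points collapses to a count.\<close>

lemma campbell_formula:
  assumes B [measurable]: "B \<in> sets M" and S [measurable]: "S \<in> sets (counting_algebra M)"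
    and ae: "AE \<omega> in P. \<forall>y\<in>B. (\<forall>C\<in>sets M. indicator C y \<le> emeasure (\<xi> \<omega>) C) \<longrightarrow>
      (remove_point (\<xi> \<omega>) y \<in> S \<longleftrightarrow> Q \<omega>)"
  shows "(\<integral>\<^sup>+\<omega>. emeasure (\<xi> \<omega>) B * of_bool (Q \<omega>) \<partial>P) =
    (\<integral>\<^sup>+\<omega>. conditional_mass B \<omega> * indicator S (\<xi> \<omega>) \<partial>P)"
proof -
  have X: "X i \<in> P \<rightarrow>\<^sub>M M" for i
    using proper by (auto simp: proper_point_process_def)
  have \<xi>: "AE \<omega> in P. \<xi> \<omega> = dirac_sum M (\<tau> \<omega>) (\<lambda>i. X i \<omega>)"
    using proper by (auto simp: proper_point_process_def)
  have "(\<integral>\<^sup>+\<omega>. emeasure (\<xi> \<omega>) B * of_bool (Q \<omega>) \<partial>P) =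
      (\<integral>\<^sup>+\<omega>. \<integral>\<^sup>+x. indicator (B \<times> S) (x, remove_point (\<xi> \<omega>) x)
        \<partial>dirac_sum (count_space (space M)) (\<tau> \<omega>) (\<lambda>i. X i \<omega>) \<partial>P)"
  proof (rule nn_integral_cong_AE)
    show "AE \<omega> in P. emeasure (\<xi> \<omega>) B * of_bool (Q \<omega>) =
        (\<integral>\<^sup>+x. indicator (B \<times> S) (x, remove_point (\<xi> \<omega>) x)
          \<partial>dirac_sum (count_space (space M)) (\<tau> \<omega>) (\<lambda>i. X i \<omega>))"
      using ae \<xi> AE_space
    proof eventually_elim
      case (elim \<omega>)
      show ?case
        using elim measurable_space[OF X elim(3)]
        by (intro nn_integral_dirac_sum_remove_point[OF elim(2) _ B, symmetric]) auto
    qed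
  qed
  also have "\<dots> = emeasure (reduced_campbell P M \<xi> X \<tau>) (B \<times> S)"
    using proper by (intro emeasure_reduced_campbell[symmetric]) measurable
  also have "\<dots> = (\<integral>\<^sup>+\<omega>. conditional_mass B \<omega> * indicator S (\<xi> \<omega>) \<partial>P)"
    using B S by (rule emeasure_reduced_campbell_times)
  finally show ?thesis .
qed

section \<open>Finite intensity and integrability of the counts\<close>

lemma conditional_mass_finite:
  assumes [measurable]: "B \<in> sets M"
  shows "(\<integral>\<^sup>+\<omega>. conditional_mass B \<omega> \<partial>P) < \<infinity>"
proof -
  interpret pair_sigma_finite \<nu> P by (rule pair_P_\<nu>)
  have "(\<integral>\<^sup>+\<omega>. conditional_mass B \<omega> \<partial>P) \<le> (\<integral>\<^sup>+\<omega>. \<integral>\<^sup>+x. ennreal \<bar>c (x, \<xi> \<omega>)\<bar> \<partial>\<nu> \<partial>P)"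
    unfolding conditional_mass_def
    by (intro nn_integral_mono) (auto simp: indicator_def intro: ennreal_leI)
  also have "\<dots> = (\<integral>\<^sup>+x. \<integral>\<^sup>+\<omega>. ennreal \<bar>c (x, \<xi> \<omega>)\<bar> \<partial>P \<partial>\<nu>)"
    by (rule Fubini') measurable
  finally show ?thesis using intensity_finite by simp
qed

text \<open>The Campbell formula with \<open>S\<close> the whole space. Together with
  \<open>conditional_mass_finite\<close> it shows that \<open>\<xi>\<close> has finite
  intensity.\<close>

lemma intensity_eq:
  assumes "B \<in> sets M"
  shows "(\<integral>\<^sup>+\<omega>. emeasure (\<xi> \<omega>) B \<partial>P) = (\<integral>\<^sup>+\<omega>. conditional_mass B \<omega> \<partial>P)"
proof -
  have "(\<integral>\<^sup>+\<omega>. emeasure (\<xi> \<omega>) B * of_bool True \<partial>P) =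
      (\<integral>\<^sup>+\<omega>. conditional_mass B \<omega> * indicator (space (counting_algebra M)) (\<xi> \<omega>) \<partial>P)"
  proof (rule campbell_formula[OF assms])
    show "AE \<omega> in P. \<forall>y\<in>B. (\<forall>C\<in>sets M. indicator C y \<le> emeasure (\<xi> \<omega>) C) \<longrightarrow>
        (remove_point (\<xi> \<omega>) y \<in> space (counting_algebra M) \<longleftrightarrow> True)"
      using \<xi>_counting by (auto simp: space_counting_algebra remove_point_counting_measures)
  qed simp
  also have "\<dots> = (\<integral>\<^sup>+\<omega>. conditional_mass B \<omega> \<partial>P)"
    by (intro nn_integral_cong) (simp add: measurable_space[OF \<xi>_measurable])
  finally show ?thesis by simp
qed

lemma AE_finite:
  assumes "B \<in> sets M"
  shows "AE \<omega> in P. emeasure (\<xi> \<omega>) B \<noteq> \<infinity>"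
    and "AE \<omega> in P. conditional_mass B \<omega> \<noteq> \<infinity>"
proof -
  note [measurable] = measurable_emeasure_counting_algebra assms
  show "AE \<omega> in P. emeasure (\<xi> \<omega>) B \<noteq> \<infinity>"
    using conditional_mass_finite[OF assms] intensity_eq[OF assms]
    by (intro nn_integral_noteq_infinite) auto
  show "AE \<omega> in P. conditional_mass B \<omega> \<noteq> \<infinity>"
    using conditional_mass_finite[OF assms] by (intro nn_integral_noteq_infinite) auto
qed

lemma conditional_mass_integrable:
  assumes [measurable]: "B \<in> sets M"
  shows "integrable P (\<lambda>\<omega>. enn2real (conditional_mass B \<omega>))"
proof (rule integrableI_bounded)
  have "(\<integral>\<^sup>+\<omega>. ennreal (norm (enn2real (conditional_mass B \<omega>))) \<partial>P) \<le> (\<integral>\<^sup>+\<omega>. conditional_mass B \<omega> \<partial>P)"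
    by (intro nn_integral_mono) (simp add: ennreal_enn2real_if)
  then show "(\<integral>\<^sup>+\<omega>. ennreal (norm (enn2real (conditional_mass B \<omega>))) \<partial>P) < \<infinity>"
    using conditional_mass_finite[OF assms] by (rule order.strict_trans1)
qed measurable

lemma count_eq_emeasure:
  assumes "B \<in> sets M"
  shows "AE \<omega> in P. ennreal (real (nat \<lfloor>measure (\<xi> \<omega>) B\<rfloor>)) = emeasure (\<xi> \<omega>) B"
  using AE_finite(1)[OF assms] AE_space
  by eventually_elim
    (metis assms emeasure_counting_measure ennreal_of_nat_eq_real_of_nat \<xi>_counting)

lemma count_integrable:
  assumes [measurable]: "B \<in> sets M"
  shows "integrable P (\<lambda>\<omega>. real (nat \<lfloor>measure (\<xi> \<omega>) B\<rfloor>))"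
proof (rule integrableI_bounded)
  show "(\<lambda>\<omega>. real (nat \<lfloor>measure (\<xi> \<omega>) B\<rfloor>)) \<in> borel_measurable P"
    using measurable_compose[OF \<xi>_measurable measurable_count[OF assms]] by measurable
  have "(\<integral>\<^sup>+\<omega>. ennreal (norm (real (nat \<lfloor>measure (\<xi> \<omega>) B\<rfloor>))) \<partial>P) = (\<integral>\<^sup>+\<omega>. emeasure (\<xi> \<omega>) B \<partial>P)"
    using count_eq_emeasure[OF assms] by (intro nn_integral_cong_AE) auto
  then show "(\<integral>\<^sup>+\<omega>. ennreal (norm (real (nat \<lfloor>measure (\<xi> \<omega>) B\<rfloor>))) \<partial>P) < \<infinity>"
    using conditional_mass_finite[OF assms] intensity_eq[OF assms] by simp
qed

lemma count_vector_integrable: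
  assumes A: "A \<in> disjoint_tuples M d" and g: "g \<in> lipschitz1 d"
  shows "integrable P (\<lambda>\<omega>. g (count_vector d A (\<xi> \<omega>)))"
proof (rule lipschitz1_integrable[OF _ g])
  show "(\<lambda>\<omega>. count_vector d A (\<xi> \<omega>)) \<in> P \<rightarrow>\<^sub>M count_space UNIV"
    using A by (intro measurable_compose[OF \<xi>_measurable measurable_count_vector])
      (auto simp: disjoint_tuples_def)
  show "integrable P (\<lambda>\<omega>. real (count_vector d A (\<xi> \<omega>) ! i))" if "i < d" for i
    using A that count_integrable[of "A i"] by (simp add: disjoint_tuples_def)
qed (simp_all add: finite_measure_axioms)

text \<open>Removing a point of \<open>A i\<close> from \<open>\<xi>\<close> lowers the \<open>i\<close>-th count by one; when that count is \<open>0\<close>, the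
  truncated subtraction is harmless because of the factor \<open>V \<omega> ! i\<close>.\<close>

lemma expectation_count_vector_reduced:
  fixes H :: "nat list \<Rightarrow> real"
  assumes A: "A \<in> disjoint_tuples M d" and i: "i < d"
  defines "V \<equiv> \<lambda>\<omega>. count_vector d A (\<xi> \<omega>)"
  shows "expectation (\<lambda>\<omega>. real (V \<omega> ! i) * H ((V \<omega>)[i := V \<omega> ! i - 1])) =
    expectation (\<lambda>\<omega>. enn2real (conditional_mass (A i) \<omega>) * H (V \<omega>))"
proof -
  let ?L = "count_space UNIV :: nat list measure"
  let ?N = "\<lambda>\<omega>. real (V \<omega> ! i)" and ?W = "\<lambda>\<omega>. (V \<omega>)[i := V \<omega> ! i - 1]"
    and ?C = "\<lambda>\<omega>. enn2real (conditional_mass (A i) \<omega>)"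
  have Aj [measurable]: "A j \<in> sets M" if "j < d" for j
    using A that by (auto simp: disjoint_tuples_def)
  note Ai [measurable] = Aj[OF i]
  have cv [measurable]: "count_vector d A \<in> counting_algebra M \<rightarrow>\<^sub>M ?L"
    using Aj by (rule measurable_count_vector)
  have V [measurable]: "V \<in> P \<rightarrow>\<^sub>M ?L" unfolding V_def by measurable
  have W [measurable]: "?W \<in> P \<rightarrow>\<^sub>M ?L"
    by (rule measurable_compose[OF V]) simp
  have N [measurable]: "?N \<in> borel_measurable P"
    by (rule measurable_compose[OF V]) simp
  have fin: "AE \<omega> in P. \<forall>j<d. emeasure (\<xi> \<omega>) (A j) \<noteq> \<infinity>"
    using AE_finite(1)[OF Aj] by (auto simp: AE_all_countable)
  \<comment> \<open>The two weighted laws are compared as measures on lists; equality of the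
    integrals then follows for every \<open>H\<close>, integrable or not.\<close>
  have "distr (density P ?N) ?L ?W = distr (density P ?C) ?L V"
  proof (rule measure_eqI)
    fix D assume "D \<in> sets (distr (density P ?N) ?L ?W)"
    let ?S = "count_vector d A -` D \<inter> space (counting_algebra M)"
    have S: "?S \<in> sets (counting_algebra M)" by (rule measurable_sets[OF cv]) simp
    have "emeasure (distr (density P ?N) ?L ?W) D =
        (\<integral>\<^sup>+\<omega>. ennreal (?N \<omega>) * indicator (?W -` D \<inter> space P) \<omega> \<partial>P)"
      using measurable_sets[OF W, of D] by (simp add: emeasure_distr emeasure_density)
    also have "\<dots> = (\<integral>\<^sup>+\<omega>. emeasure (\<xi> \<omega>) (A i) * of_bool (?W \<omega> \<in> D) \<partial>P)"
      using count_eq_emeasure[OF Ai] AE_space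
      by (intro nn_integral_cong_AE, eventually_elim) (auto simp: V_def i indicator_def)
    also have "\<dots> = (\<integral>\<^sup>+\<omega>. conditional_mass (A i) \<omega> * indicator ?S (\<xi> \<omega>) \<partial>P)"
    proof (rule campbell_formula[OF Ai S])
      show "AE \<omega> in P. \<forall>y\<in>A i. (\<forall>C\<in>sets M. indicator C y \<le> emeasure (\<xi> \<omega>) C) \<longrightarrow>
          (remove_point (\<xi> \<omega>) y \<in> ?S \<longleftrightarrow> ?W \<omega> \<in> D)"
        using fin AE_space
      proof eventually_elim
        case (elim \<omega>)
        show ?case
        proof (intro ballI impI)
          fix y assume y: "y \<in> A i" and le: "\<forall>C\<in>sets M. indicator C y \<le> emeasure (\<xi> \<omega>) C"
          have "count_vector d A (remove_point (\<xi> \<omega>) y) = ?W \<omega>"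
            unfolding V_def using elim le
            by (intro count_vector_remove_point[OF A i y \<xi>_counting]) auto
          then show "remove_point (\<xi> \<omega>) y \<in> ?S \<longleftrightarrow> ?W \<omega> \<in> D"
            using remove_point_counting_measures[OF \<xi>_counting[OF elim(2)]]
            by (simp add: space_counting_algebra)
        qed
      qed
    qed
    \<comment> \<open>\<open>enn2real\<close> turns infinite values into \<open>0\<close>, but these
      occur only on a null set.\<close>
    also have "\<dots> = (\<integral>\<^sup>+\<omega>. ennreal (?C \<omega>) * indicator (V -` D \<inter> space P) \<omega> \<partial>P)"
      using AE_finite(2)[OF Ai] AE_space
      by (intro nn_integral_cong_AE, eventually_elim)
        (use \<xi>_counting in \<open>auto simp: V_def indicator_def ennreal_enn2real_if space_counting_algebra\<close>)
    also have "\<dots> = emeasure (distr (density P ?C) ?L V) D"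
      using measurable_sets[OF V, of D] by (simp add: emeasure_distr emeasure_density)
    finally show "emeasure (distr (density P ?N) ?L ?W) D = emeasure (distr (density P ?C) ?L V) D" .
  qed simp
  then have "(\<integral>x. H x \<partial>distr (density P ?N) ?L ?W) = (\<integral>x. H x \<partial>distr (density P ?C) ?L V)"
    by simp
  then show ?thesis by (simp add: integral_distr integral_density)
qed

text \<open>Stein's method in the \<open>i\<close>-th coordinate only: removing a point of \<open>A i\<close> does not affect the
  other counts, so the solution of the one-dimensional Stein equation may depend on them.\<close>

lemma resample_error:
  assumes A: "A \<in> disjoint_tuples M d" and i: "i < d" and g: "g \<in> lipschitz1 d" and l: "0 \<le> l"
  shows "\<bar>expectation (\<lambda>\<omega>. g (count_vector d A (\<xi> \<omega>))) -
      expectation (\<lambda>\<omega>. resample (poisson_law l) i g (count_vector d A (\<xi> \<omega>)))\<bar>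
    \<le> expectation (\<lambda>\<omega>. \<bar>l - enn2real (conditional_mass (A i) \<omega>)\<bar>)"
proof -
  define V where "V \<omega> = count_vector d A (\<xi> \<omega>)" for \<omega>
  define H where "H x = stein_solution l (\<lambda>k. g (x[i := k])) (x ! i)" for x
  let ?r = "resample (poisson_law l) i g" and ?W = "\<lambda>\<omega>. (V \<omega>)[i := V \<omega> ! i - 1]"
    and ?C = "\<lambda>\<omega>. enn2real (conditional_mass (A i) \<omega>)"
  have Ai: "A i \<in> sets M" using A i by (simp add: disjoint_tuples_def)
  have V [measurable]: "V \<in> P \<rightarrow>\<^sub>M count_space UNIV"
    unfolding V_def[abs_def] using A
    by (intro measurable_compose[OF \<xi>_measurable measurable_count_vector])
      (auto simp: disjoint_tuples_def)
  have [simp]: "length (V \<omega>) = d" for \<omega> by (simp add: V_def)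
  have r: "?r \<in> lipschitz1 d"
    using poisson_law_mean(1)[OF l] g by (rule resample_lipschitz1)
  have H_bound: "\<bar>H x\<bar> \<le> 1" if "length x = d" for x
    unfolding H_def using l lipschitz1_list_update[OF g that] by (rule stein_solution_bound)
  \<comment> \<open>Updating position \<open>i\<close> leaves the function
    \<open>\<lambda>k. g (x[i := k])\<close> unchanged, so \<open>H (?W \<omega>)\<close> is the
    same Stein solution evaluated one step lower.\<close>
  have stein: "g (V \<omega>) - ?r (V \<omega>) = l * H (V \<omega>) - real (V \<omega> ! i) * H (?W \<omega>)" for \<omega>
    using stein_equation[OF l, of "\<lambda>k. g ((V \<omega>)[i := k])" "V \<omega> ! i"] i
    by (simp add: resample_def H_def)
  have meas: "(\<lambda>\<omega>. H (V \<omega>)) \<in> borel_measurable P" "(\<lambda>\<omega>. H (?W \<omega>)) \<in> borel_measurable P"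
    by (rule measurable_compose[OF V], simp)+
  have int_C: "integrable P ?C" using Ai by (rule conditional_mass_integrable)
  have int_N: "integrable P (\<lambda>\<omega>. real (V \<omega> ! i))"
    using count_integrable[OF Ai] i by (simp add: V_def)
  have int_CH: "integrable P (\<lambda>\<omega>. ?C \<omega> * H (V \<omega>))"
  proof (rule Bochner_Integration.integrable_bound[OF int_C])
    show "AE \<omega> in P. norm (?C \<omega> * H (V \<omega>)) \<le> norm (?C \<omega>)"
      using H_bound by (auto simp: abs_mult intro!: mult_left_le)
  qed (use meas borel_measurable_integrable[OF int_C] in measurable)
  have int_NH: "integrable P (\<lambda>\<omega>. real (V \<omega> ! i) * H (?W \<omega>))"
  proof (rule Bochner_Integration.integrable_bound[OF int_N])
    show "AE \<omega> in P. norm (real (V \<omega> ! i) * H (?W \<omega>)) \<le> norm (real (V \<omega> ! i))"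
      using H_bound by (auto simp: abs_mult intro!: mult_left_le)
  qed (use meas borel_measurable_integrable[OF int_N] in measurable)
  have int_H: "integrable P (\<lambda>\<omega>. H (V \<omega>))"
    using meas(1) H_bound by (intro integrable_const_bound[where B=1]) auto
  have "expectation (\<lambda>\<omega>. g (V \<omega>)) - expectation (\<lambda>\<omega>. ?r (V \<omega>)) =
      expectation (\<lambda>\<omega>. g (V \<omega>) - ?r (V \<omega>))"
    unfolding V_def using count_vector_integrable[OF A g] count_vector_integrable[OF A r] by simp
  also have "\<dots> = expectation (\<lambda>\<omega>. l * H (V \<omega>) - real (V \<omega> ! i) * H (?W \<omega>))"
    by (simp only: stein)
  also have "\<dots> = expectation (\<lambda>\<omega>. l * H (V \<omega>)) - expectation (\<lambda>\<omega>. real (V \<omega> ! i) * H (?W \<omega>))"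
    using int_H int_NH by simp
  \<comment> \<open>Size-biasing gives both terms the common factor \<open>H (V \<omega>)\<close>,
    which is bounded by \<open>1\<close>.\<close>
  also have "expectation (\<lambda>\<omega>. real (V \<omega> ! i) * H (?W \<omega>)) = expectation (\<lambda>\<omega>. ?C \<omega> * H (V \<omega>))"
    unfolding V_def by (rule expectation_count_vector_reduced[OF A i])
  also have "expectation (\<lambda>\<omega>. l * H (V \<omega>)) - \<dots> = expectation (\<lambda>\<omega>. (l - ?C \<omega>) * H (V \<omega>))"
    using int_H int_CH by (simp add: left_diff_distrib)
  also have "\<bar>\<dots>\<bar> \<le> expectation (\<lambda>\<omega>. \<bar>(l - ?C \<omega>) * H (V \<omega>)\<bar>)"
    by (rule integral_abs_bound)
  also have "\<dots> \<le> expectation (\<lambda>\<omega>. \<bar>l - ?C \<omega>\<bar>)"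
  proof (rule integral_mono)
    show "integrable P (\<lambda>\<omega>. \<bar>(l - ?C \<omega>) * H (V \<omega>)\<bar>)"
      using int_H int_CH by (simp add: left_diff_distrib)
    show "\<bar>(l - ?C \<omega>) * H (V \<omega>)\<bar> \<le> \<bar>l - ?C \<omega>\<bar>" for \<omega>
      using H_bound[of "V \<omega>"] by (auto simp: abs_mult intro!: mult_left_le)
  qed (use int_C in simp)
  finally show ?thesis unfolding V_def .
qed

text \<open>For almost every \<open>\<omega>\<close> the two masses are integrals over
  \<open>B\<close> against the same \<open>\<nu>\<close>, of \<open>f\<close> and of
  \<open>c\<close>, so their distance is at most the integrated distance of the densities.\<close>

lemma resample_error_le_density_error:
  assumes B [measurable]: "B \<in> sets M"
    and f [measurable]: "f \<in> borel_measurable M"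
    and \<Lambda>: "\<Lambda> = density \<nu> (\<lambda>x. ennreal (f x))" "finite_measure \<Lambda>"
  shows "ennreal (expectation (\<lambda>\<omega>. \<bar>measure \<Lambda> B - enn2real (conditional_mass B \<omega>)\<bar>))
    \<le> (\<integral>\<^sup>+\<omega>. \<integral>\<^sup>+x. ennreal \<bar>c (x, \<xi> \<omega>) - f x\<bar> * indicator B x \<partial>\<nu> \<partial>P)"
proof -
  have mass: "conditional_mass B \<omega> = (\<integral>\<^sup>+x. ennreal (c (x, \<xi> \<omega>) * indicator B x) \<partial>\<nu>)" for \<omega>
    unfolding conditional_mass_def by (intro nn_integral_cong) (auto simp: indicator_def)
  have "emeasure \<Lambda> B = (\<integral>\<^sup>+x. ennreal (f x * indicator B x) \<partial>\<nu>)"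
    unfolding \<Lambda>(1) by (subst emeasure_density) (auto simp: indicator_def intro!: nn_integral_cong)
  then have \<Lambda>B: "measure \<Lambda> B = enn2real (\<integral>\<^sup>+x. ennreal (f x * indicator B x) \<partial>\<nu>)"
    and fin: "(\<integral>\<^sup>+x. ennreal (f x * indicator B x) \<partial>\<nu>) \<noteq> \<infinity>"
    using finite_measure.emeasure_finite[OF \<Lambda>(2), of B] by (auto simp: measure_def)
  have "ennreal (expectation (\<lambda>\<omega>. \<bar>measure \<Lambda> B - enn2real (conditional_mass B \<omega>)\<bar>)) =
      (\<integral>\<^sup>+\<omega>. ennreal \<bar>measure \<Lambda> B - enn2real (conditional_mass B \<omega>)\<bar> \<partial>P)"
    using conditional_mass_integrable[OF B] by (intro nn_integral_eq_integral[symmetric]) auto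
  also have "\<dots> \<le> (\<integral>\<^sup>+\<omega>. \<integral>\<^sup>+x. ennreal \<bar>c (x, \<xi> \<omega>) - f x\<bar> * indicator B x \<partial>\<nu> \<partial>P)"
  proof (rule nn_integral_mono_AE)
    show "AE \<omega> in P. ennreal \<bar>measure \<Lambda> B - enn2real (conditional_mass B \<omega>)\<bar>
        \<le> (\<integral>\<^sup>+x. ennreal \<bar>c (x, \<xi> \<omega>) - f x\<bar> * indicator B x \<partial>\<nu>)"
      using AE_finite(2)[OF B] AE_space
    proof eventually_elim
      case (elim \<omega>)
      have [measurable]: "(\<lambda>x. c (x, \<xi> \<omega>)) \<in> borel_measurable \<nu>"
        using measurable_space[OF \<xi>_measurable elim(2)] by measurable
      have "ennreal \<bar>measure \<Lambda> B - enn2real (conditional_mass B \<omega>)\<bar>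
          \<le> (\<integral>\<^sup>+x. ennreal \<bar>f x * indicator B x - c (x, \<xi> \<omega>) * indicator B x\<bar> \<partial>\<nu>)"
        unfolding \<Lambda>B mass using fin elim(1) by (intro abs_diff_nn_integral_le) (auto simp: mass)
      also have "\<dots> = (\<integral>\<^sup>+x. ennreal \<bar>c (x, \<xi> \<omega>) - f x\<bar> * indicator B x \<partial>\<nu>)"
        by (intro nn_integral_cong) (auto simp: indicator_def abs_minus_commute)
      finally show ?case .
    qed
  qed
  finally show ?thesis .
qed

text \<open>Disjointness bounds the sum of the indicators by \<open>1\<close>, so the coordinate
  errors add up without a factor depending on \<open>d\<close>.\<close>

lemma density_error_disjoint:
  assumes A: "A \<in> disjoint_tuples M d" and f [measurable]: "f \<in> borel_measurable M"
  shows "(\<Sum>i<d. \<integral>\<^sup>+\<omega>. \<integral>\<^sup>+x. ennreal \<bar>c (x, \<xi> \<omega>) - f x\<bar> * indicator (A i) x \<partial>\<nu> \<partial>P)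
    \<le> (\<integral>\<^sup>+x. \<integral>\<^sup>+\<omega>. ennreal \<bar>c (x, \<xi> \<omega>) - f x\<bar> \<partial>P \<partial>\<nu>)"
proof -
  interpret pair_sigma_finite \<nu> P by (rule pair_P_\<nu>)
  have [measurable]: "A i \<in> sets M" if "i \<in> {..<d}" for i
    using A that by (simp add: disjoint_tuples_def)
  have ind: "(\<Sum>i<d. indicator (A i) x :: ennreal) \<le> 1" for x
  proof (cases "\<exists>i<d. x \<in> A i")
    case True
    then obtain i where i: "i < d" "x \<in> A i" by auto
    then have "(\<Sum>j<d. indicator (A j) x :: ennreal) = (\<Sum>j<d. if j = i then 1 else 0)"
      using A by (intro sum.cong) (auto simp: disjoint_tuples_def disjoint_family_on_def indicator_def)
    then show ?thesis using i by simp
  qed (simp add: indicator_def)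
  have "(\<Sum>i<d. \<integral>\<^sup>+\<omega>. \<integral>\<^sup>+x. ennreal \<bar>c (x, \<xi> \<omega>) - f x\<bar> * indicator (A i) x \<partial>\<nu> \<partial>P) =
      (\<Sum>i<d. \<integral>\<^sup>+x. \<integral>\<^sup>+\<omega>. ennreal \<bar>c (x, \<xi> \<omega>) - f x\<bar> * indicator (A i) x \<partial>P \<partial>\<nu>)"
    by (intro sum.cong refl Fubini') measurable
  also have "\<dots> = (\<integral>\<^sup>+x. (\<Sum>i<d. \<integral>\<^sup>+\<omega>. ennreal \<bar>c (x, \<xi> \<omega>) - f x\<bar> * indicator (A i) x \<partial>P) \<partial>\<nu>)"
    by (intro nn_integral_sum[symmetric]) measurable
  also have "\<dots> \<le> (\<integral>\<^sup>+x. \<integral>\<^sup>+\<omega>. ennreal \<bar>c (x, \<xi> \<omega>) - f x\<bar> \<partial>P \<partial>\<nu>)"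
  proof (rule nn_integral_mono)
    fix x assume "x \<in> space \<nu>"
    then have [measurable]: "(\<lambda>\<omega>. c (x, \<xi> \<omega>)) \<in> borel_measurable P"
      by (simp add: space_\<nu>)
    have "(\<Sum>i<d. \<integral>\<^sup>+\<omega>. ennreal \<bar>c (x, \<xi> \<omega>) - f x\<bar> * indicator (A i) x \<partial>P) =
        (\<integral>\<^sup>+\<omega>. ennreal \<bar>c (x, \<xi> \<omega>) - f x\<bar> \<partial>P) * (\<Sum>i<d. indicator (A i) x)"
      unfolding sum_distrib_left by (intro sum.cong refl nn_integral_multc) measurable
    also have "\<dots> \<le> (\<integral>\<^sup>+\<omega>. ennreal \<bar>c (x, \<xi> \<omega>) - f x\<bar> \<partial>P) * 1"
      using ind by (intro mult_left_mono) auto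
    finally show "(\<Sum>i<d. \<integral>\<^sup>+\<omega>. ennreal \<bar>c (x, \<xi> \<omega>) - f x\<bar> * indicator (A i) x \<partial>P) \<le>
        (\<integral>\<^sup>+\<omega>. ennreal \<bar>c (x, \<xi> \<omega>) - f x\<bar> \<partial>P)" by simp
  qed
  finally show ?thesis .
qed

end

section \<open>The Poisson process and the bound\<close>

text \<open>The probabilities of the finite counts sum to one, so an infinite count has probability
  \<open>0\<close> and the default value \<open>0\<close> given to it by \<open>measure\<close> does
  not disturb the law.\<close>

lemma poisson_process_count_distr:
  assumes \<eta>: "poisson_process Q M \<eta> \<Lambda>" and fin: "finite_measure \<Lambda>" and B: "B \<in> sets M"
  shows "distr Q (count_space UNIV) (\<lambda>\<omega>. nat \<lfloor>measure (\<eta> \<omega>) B\<rfloor>) = measure_pmf (poisson_law (measure \<Lambda> B))"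
proof -
  let ?p = "poisson_law (measure \<Lambda> B)" and ?N = "\<lambda>\<omega>. nat \<lfloor>measure (\<eta> \<omega>) B\<rfloor>"
    and ?E = "\<lambda>k. {\<omega> \<in> space Q. emeasure (\<eta> \<omega>) B = of_nat k}"
  interpret Q: prob_space Q using \<eta> by (simp add: poisson_process_def point_process_def)
  have meas: "\<eta> \<in> Q \<rightarrow>\<^sub>M counting_algebra M"
    using \<eta> by (simp add: poisson_process_def point_process_def)
  note [measurable] = measurable_compose[OF meas measurable_emeasure_counting_algebra[OF B]]
    measurable_compose[OF meas measurable_count[OF B]]
  have prob: "Q.prob (?E k) = pmf ?p k" for k
    using \<eta> B finite_measure.emeasure_finite[OF fin, of B]
    by (auto simp: poisson_process_def pmf_poisson_law)
  have E: "?E k \<in> sets Q" for k by measurable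
  have "disjoint_family ?E" by (auto simp: disjoint_family_on_def)
  then have "(\<lambda>k. pmf ?p k) sums Q.prob (\<Union>k. ?E k)"
    using Q.finite_measure_UNION[of ?E, OF image_subsetI[OF E]] by (simp only: prob)
  moreover have "(\<lambda>k. pmf ?p k) sums 1"
    using measure_pmf.finite_measure_UNION[of "\<lambda>k. {k}" ?p]
    by (auto simp: disjoint_family_on_def measure_pmf_single)
  ultimately have "Q.prob (\<Union>k. ?E k) = 1" by (rule sums_unique2)
  then have ae: "AE \<omega> in Q. \<omega> \<in> (\<Union>k. ?E k)"
    using E by (intro Q.AE_prob_1) auto
  show ?thesis
  proof (rule measure_eqI_countable[of _ UNIV])
    fix k :: nat
    have "emeasure (distr Q (count_space UNIV) ?N) {k} = emeasure Q (?N -` {k} \<inter> space Q)"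
      by (simp add: emeasure_distr)
    also have "\<dots> = emeasure Q (?E k)"
    proof (rule emeasure_eq_AE)
      show "AE \<omega> in Q. \<omega> \<in> ?N -` {k} \<inter> space Q \<longleftrightarrow> \<omega> \<in> ?E k"
        using ae by eventually_elim (auto simp: measure_def)
    qed measurable
    also have "\<dots> = emeasure (measure_pmf ?p) {k}"
      by (simp add: Q.emeasure_eq_measure prob emeasure_pmf_single)
    finally show "emeasure (distr Q (count_space UNIV) ?N) {k} = emeasure (measure_pmf ?p) {k}" .
  qed simp_all
qed

text \<open>The counts of \<open>\<eta>\<close> are independent with these very laws, so resampling
  is taking a conditional expectation. This supplies the exact side \<open>E2\<close> of
  \<open>resample_telescope\<close>.\<close>

lemma poisson_process_resample:
  assumes \<eta>: "poisson_process Q M \<eta> \<Lambda>" and fin: "finite_measure \<Lambda>"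
    and A: "A \<in> disjoint_tuples M d" and i: "i < d" and g: "g \<in> lipschitz1 d"
  shows "(\<integral>\<omega>. g (count_vector d A (\<eta> \<omega>)) \<partial>Q) =
    (\<integral>\<omega>. resample (poisson_law (measure \<Lambda> (A i))) i g (count_vector d A (\<eta> \<omega>)) \<partial>Q)"
proof -
  interpret Q: prob_space Q using \<eta> by (simp add: poisson_process_def point_process_def)
  have meas: "\<eta> \<in> Q \<rightarrow>\<^sub>M counting_algebra M"
    using \<eta> by (simp add: poisson_process_def point_process_def)
  have A_sets: "A j \<in> sets M" if "j < d" for j using A that by (simp add: disjoint_tuples_def)
  show ?thesis
  proof (rule Q.expectation_resample[OF _ _ i])
    have "Q.indep_vars (\<lambda>_. borel) (\<lambda>j \<omega>. emeasure (\<eta> \<omega>) (A j)) {..<d}"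
      using \<eta> A by (auto simp: poisson_process_def disjoint_tuples_def)
    \<comment> \<open>Independence is given for counts in \<open>ennreal\<close>; it survives the
      coordinatewise map to naturals.\<close>
    then have "Q.indep_vars (\<lambda>_. count_space UNIV) (\<lambda>j \<omega>. nat \<lfloor>enn2real (emeasure (\<eta> \<omega>) (A j))\<rfloor>) {..<d}"
      by (rule Q.indep_vars_compose2) measurable
    then show "Q.indep_vars (\<lambda>_. count_space UNIV) (\<lambda>j \<omega>. count_vector d A (\<eta> \<omega>) ! j) {..<d}"
      by (subst Q.indep_vars_cong[OF refl _ refl]) (auto simp: measure_def)
    show "distr Q (count_space UNIV) (\<lambda>\<omega>. count_vector d A (\<eta> \<omega>) ! i) =
        measure_pmf (poisson_law (measure \<Lambda> (A i)))"
      using poisson_process_count_distr[OF \<eta> fin A_sets[OF i]] i by simp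
    show "integrable Q (\<lambda>\<omega>. g (count_vector d A (\<eta> \<omega>)))"
    proof (rule lipschitz1_integrable[OF _ g])
      show "(\<lambda>\<omega>. count_vector d A (\<eta> \<omega>)) \<in> Q \<rightarrow>\<^sub>M count_space UNIV"
        using A_sets by (intro measurable_compose[OF meas measurable_count_vector])
      fix j assume j: "j < d"
      have "integrable (distr Q (count_space UNIV) (\<lambda>\<omega>. nat \<lfloor>measure (\<eta> \<omega>) (A j)\<rfloor>)) real"
        unfolding poisson_process_count_distr[OF \<eta> fin A_sets[OF j]]
        by (simp add: poisson_law_mean)
      then show "integrable Q (\<lambda>\<omega>. real (count_vector d A (\<eta> \<omega>) ! j))"
        using j measurable_compose[OF meas measurable_count[OF A_sets[OF j]]]
        by (subst (asm) integrable_distr_eq) auto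
    qed (simp_all add: Q.finite_measure_axioms)
  qed simp
qed

theorem theorem3p3:
  fixes M \<nu> :: "'a measure"
    and P :: "'v measure" and \<xi> :: "'v \<Rightarrow> 'a measure"
    and X :: "nat \<Rightarrow> 'v \<Rightarrow> 'a" and \<tau> :: "'v \<Rightarrow> enat"
    and c :: "'a \<times> 'a measure \<Rightarrow> real"
    and Q :: "'w measure" and \<eta> :: "'w \<Rightarrow> 'a measure"
    and \<Lambda> :: "'a measure" and f :: "'a \<Rightarrow> real"
  assumes "sets \<nu> = sets M" and "sigma_finite_measure \<nu>"
    and "proper_point_process P M \<xi> X \<tau>"
    and "papangelou_intensity P M \<xi> X \<tau> \<nu> c"
    and "(\<integral>\<^sup>+x. \<integral>\<^sup>+\<omega>. ennreal \<bar>c (x, \<xi> \<omega>)\<bar> \<partial>P \<partial>\<nu>) < \<infinity>"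
    and "poisson_process Q M \<eta> \<Lambda>" and "finite_measure \<Lambda>"
    and "f \<in> borel_measurable M" and "\<And>x. x \<in> space M \<Longrightarrow> 0 \<le> f x"
    and "\<Lambda> = density \<nu> (\<lambda>x. ennreal (f x))"
  shows "d_pi M P \<xi> Q \<eta> \<le> (\<integral>\<^sup>+x. \<integral>\<^sup>+\<omega>. ennreal \<bar>c (x, \<xi> \<omega>) - f x\<bar> \<partial>P \<partial>\<nu>)"
  unfolding d_pi_def wasserstein_dist_def
proof (intro SUP_least)
  interpret \<xi>: papangelou_process P M \<xi> X \<tau> \<nu> c
    using assms(3,4,1,2,5) by (rule papangelou_process.intro)
  interpret Q: prob_space Q using assms(6) by (simp add: poisson_process_def point_process_def)
  fix d A g assume A: "A \<in> disjoint_tuples M d" and g: "g \<in> lipschitz1 d"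
  let ?V = "\<lambda>\<omega>. count_vector d A (\<xi> \<omega>)" and ?Z = "\<lambda>\<omega>. count_vector d A (\<eta> \<omega>)"
  let ?\<epsilon> = "\<lambda>i. \<xi>.expectation (\<lambda>\<omega>. \<bar>measure \<Lambda> (A i) - enn2real (\<xi>.conditional_mass (A i) \<omega>)\<bar>)"
  have "\<bar>(\<integral>\<omega>. g (?V \<omega>) \<partial>P) - (\<integral>\<omega>. g (?Z \<omega>) \<partial>Q)\<bar> \<le> (\<Sum>i<d. ?\<epsilon> i)"
  \<comment> \<open>\<open>E1\<close> is the expectation under \<open>\<xi>\<close>, which pays the
    Stein error at each replacement; \<open>E2\<close> is the one under
    \<open>\<eta>\<close>.\<close>
  proof (rule resample_telescope[where p="\<lambda>i. poisson_law (measure \<Lambda> (A i))"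
        and ?E1.0="\<lambda>g. \<integral>\<omega>. g (?V \<omega>) \<partial>P" and ?E2.0="\<lambda>g. \<integral>\<omega>. g (?Z \<omega>) \<partial>Q"])
    fix h :: "nat list \<Rightarrow> real"
    assume "\<And>x y. length x = d \<Longrightarrow> length y = d \<Longrightarrow> h x = h y"
    \<comment> \<open>\<open>replicate d 0\<close> is just some list of length \<open>d\<close>; on
      probability spaces both expectations equal the value of \<open>h\<close> there.\<close>
    then have "h (?V \<omega>) = h (replicate d 0)" "h (?Z \<omega>') = h (replicate d 0)" for \<omega> \<omega>'
      by (metis length_count_vector length_replicate)+
    then show "(\<integral>\<omega>. h (?V \<omega>) \<partial>P) = (\<integral>\<omega>. h (?Z \<omega>) \<partial>Q)"
      by (simp add: \<xi>.prob_space Q.prob_space)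
  qed (use A g \<xi>.resample_error poisson_process_resample[OF assms(6,7)] in
      \<open>auto simp: poisson_law_mean\<close>)
  then have "ennreal \<bar>(\<integral>\<omega>. g (?V \<omega>) \<partial>P) - (\<integral>\<omega>. g (?Z \<omega>) \<partial>Q)\<bar> \<le> ennreal (\<Sum>i<d. ?\<epsilon> i)"
    by (rule ennreal_leI)
  also have "\<dots> = (\<Sum>i<d. ennreal (?\<epsilon> i))" by (rule sum_ennreal[symmetric]) simp
  also have "\<dots> \<le> (\<Sum>i<d. \<integral>\<^sup>+\<omega>. \<integral>\<^sup>+x. ennreal \<bar>c (x, \<xi> \<omega>) - f x\<bar> * indicator (A i) x \<partial>\<nu> \<partial>P)"
    using A assms(7,8,10)
    by (intro sum_mono \<xi>.resample_error_le_density_error) (auto simp: disjoint_tuples_def)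
  also have "\<dots> \<le> (\<integral>\<^sup>+x. \<integral>\<^sup>+\<omega>. ennreal \<bar>c (x, \<xi> \<omega>) - f x\<bar> \<partial>P \<partial>\<nu>)"
    using A assms(8) by (rule \<xi>.density_error_disjoint)
  finally show "ennreal \<bar>(\<integral>\<omega>. g (?V \<omega>) \<partial>P) - (\<integral>\<omega>. g (?Z \<omega>) \<partial>Q)\<bar>
    \<le> (\<integral>\<^sup>+x. \<integral>\<^sup>+\<omega>. ennreal \<bar>c (x, \<xi> \<omega>) - f x\<bar> \<partial>P \<partial>\<nu>)" .
qed

end
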